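(* For every integer $n\ge3$ and every real $k$ with $1-n<k<0$, there exist a smooth complete asymptotically flat Riemannian metric $g$ on $\mathbb{R}^n$ and a smooth compactly supported vector field $X$ on $\mathbb{R}^n$ such that $$\mathrm{R}+2\,\mathrm{div}X\in L^1(\mathbb{R}^n,g),$$ $$\mathrm{R}_X^{(k)}=\mathrm{R}+2\,\mathrm{div}X-\left(1+\frac1k\right)|X|^2\ge0\quad\text{on }\mathbb{R}^n,$$ $$m_X(g)<0.$$
   Context: $\mathrm{R}$ is the scalar curvature, $\mathrm{div}$ the divergence and $|\cdot|$ the norm, all with respect to $g$. The Einstein summation convention is used. Big-O: for a smooth $h$ defined outside a compact subset of $\mathbb{R}^n$, $h=O_2(|x|^{-\tau})$ means there is $C>0$ with $|\partial^{\beta}h(x)|\le C|x|^{-|\beta|-\tau}$ for all $|x|$ sufficiently large and all multi-indices $0\le|\beta|\le 2$. Asymptotically flat: an $n$-dimensional Riemannian manifold $(M,g)$, $n\ge3$, is asymptotically flat if there is a compact $K\subset M$ such that $U_\infty=M\setminus K$ is diffeomorphic to $\mathbb{R}^n$ minus a closed ball centred at the origin via a coordinate map $\varphi=(x^1,\dots,x^n)$ (an asymptotically flat chart) in which $g_{ij}=\delta_{ij}+O_2(|x|^{-\tau})$ for some $\tau>(n-2)/2$ and all $i,j$. $X$-ADM mass: for a smooth compactly supported vector field $X$ (more generally one with $|X|=O(|x|^{-1-\tau_0})$ and $|\nabla X|=O(|x|^{-2-\tau_0})$ for some $\tau_0>(n-2)/2$) with $\mathrm{R}+2\,\mathrm{div}(X)\in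 L^1(M,g)$, $$m_X(g)=\frac{1}{2(n-1)|\mathbb{S}^{n-1}|}\lim_{r\to+\infty}\int_{\{|x|=r\}}\delta^i_j\big(\delta^{kl}\partial_kg_{il}-\delta^{kl}\partial_ig_{kl}+2\delta_{ik}X^k\big)\frac{x^j}{|x|}\,d\sigma_{\mathrm{eucl}},$$ computed in an asymptotically flat chart (the limit exists, is finite and does not depend on the chart). *)

theory Defs
  imports "HOL-Analysis.Analysis"
begin

subsection \<open>Partial derivatives and smoothness\<close>

definition partial_deriv ::
  "'n::finite \<Rightarrow> (real^'n \<Rightarrow> 'b::real_normed_vector) \<Rightarrow> real^'n \<Rightarrow> 'b"
  where "partial_deriv i f x = frechet_derivative f (at x) (axis i 1)"

text \<open>A multi-index of order m is given as a list of m coordinate directions.\<close>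

primrec iter_partial ::
  "'n::finite list \<Rightarrow> (real^'n \<Rightarrow> 'b::real_normed_vector) \<Rightarrow> real^'n \<Rightarrow> 'b"
  where
    "iter_partial [] f = f"
  | "iter_partial (i # is) f = partial_deriv i (iter_partial is f)"

text \<open>Smoothness; only used for open \<open>S\<close>. The partial derivatives of all orders are Frechet
  differentiable, hence continuous, on \<open>S\<close>.\<close>

definition smooth_on :: "(real^'n::finite) set \<Rightarrow> (real^'n \<Rightarrow> 'b::real_normed_vector) \<Rightarrow> bool"
  where "smooth_on S f \<longleftrightarrow> (\<forall>is. iter_partial is f differentiable_on S)"

definition bigO2 :: "real \<Rightarrow> (real^'n::finite \<Rightarrow> real) \<Rightarrow> bool"
  where "bigO2 \<tau> h \<longleftrightarrow>
    (\<exists>C>0. \<forall>\<^sub>F x in at_infinity. \<forall>is. length is \<le> 2 \<longrightarrow>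
       \<bar>iter_partial is h x\<bar> \<le> C * norm x powr (- real (length is) - \<tau>))"

subsection \<open>Riemannian metrics on Euclidean space\<close>

text \<open>A metric is given by its matrix of components in the standard coordinates, a vector field
  by its vector of components.\<close>

definition riemannian_metric :: "(real^'n::finite \<Rightarrow> real^'n^'n) \<Rightarrow> bool"
  where "riemannian_metric g \<longleftrightarrow>
    smooth_on UNIV g \<and>
    (\<forall>x. transpose (g x) = g x \<and> (\<forall>v. v \<noteq> 0 \<longrightarrow> v \<bullet> (g x *v v) > 0))"

definition metric_norm :: "(real^'n::finite \<Rightarrow> real^'n^'n) \<Rightarrow> real^'n \<Rightarrow> real^'n \<Rightarrow> real"
  where "metric_norm g x v = sqrt (v \<bullet> (g x *v v))"

definition volume_measure :: "(real^'n::finite \<Rightarrow> real^'n^'n) \<Rightarrow> (real^'n) measure"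
  where "volume_measure g = density lborel (\<lambda>x. ennreal (sqrt (det (g x))))"

definition speed :: "(real^'n::finite \<Rightarrow> real^'n^'n) \<Rightarrow> (real \<Rightarrow> real^'n) \<Rightarrow> real \<Rightarrow> real"
  where "speed g \<gamma> t = metric_norm g (\<gamma> t) (vector_derivative \<gamma> (at t))"

text \<open>A \<open>valid_path\<close> may have unbounded derivative near its finitely many exceptional
  parameters; integrability of the speed excludes curves of infinite length, for which
  \<open>integral\<close> would take the value 0.\<close>

definition riem_dist :: "(real^'n::finite \<Rightarrow> real^'n^'n) \<Rightarrow> real^'n \<Rightarrow> real^'n \<Rightarrow> real"
  where "riem_dist g x y =
    Inf {integral {0..1} (speed g \<gamma>) | \<gamma>.
      valid_path \<gamma> \<and> speed g \<gamma> integrable_on {0..1} \<and> pathstart \<gamma> = x \<and> pathfinish \<gamma> = y}"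

definition complete_metric :: "(real^'n::finite \<Rightarrow> real^'n^'n) \<Rightarrow> bool"
  where "complete_metric g \<longleftrightarrow> Metric_space.mcomplete UNIV (riem_dist g)"

subsection \<open>Curvature and divergence\<close>

text \<open>\<open>christoffel g l i j\<close> is the symbol with upper index \<open>l\<close>.\<close>

definition christoffel ::
  "(real^'n::finite \<Rightarrow> real^'n^'n) \<Rightarrow> 'n \<Rightarrow> 'n \<Rightarrow> 'n \<Rightarrow> real^'n \<Rightarrow> real"
  where "christoffel g l i j x =
    (1/2) * (\<Sum>m\<in>UNIV. matrix_inv (g x) $ l $ m *
      (partial_deriv i (\<lambda>y. g y $ j $ m) x + partial_deriv j (\<lambda>y. g y $ i $ m) x
        - partial_deriv m (\<lambda>y. g y $ i $ j) x))"

text \<open>\<open>riemann g l k i j\<close> is the \<open>l\<close>-th component of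
  \<open>\<nabla>\<^sub>i\<nabla>\<^sub>j\<partial>\<^sub>k - \<nabla>\<^sub>j\<nabla>\<^sub>i\<partial>\<^sub>k\<close>. With the contraction below, round spheres have positive
  Ricci and scalar curvature.\<close>

definition riemann ::
  "(real^'n::finite \<Rightarrow> real^'n^'n) \<Rightarrow> 'n \<Rightarrow> 'n \<Rightarrow> 'n \<Rightarrow> 'n \<Rightarrow> real^'n \<Rightarrow> real"
  where "riemann g l k i j x =
    partial_deriv i (christoffel g l j k) x - partial_deriv j (christoffel g l i k) x
    + (\<Sum>m\<in>UNIV. christoffel g l i m x * christoffel g m j k x
        - christoffel g l j m x * christoffel g m i k x)"

definition ricci :: "(real^'n::finite \<Rightarrow> real^'n^'n) \<Rightarrow> 'n \<Rightarrow> 'n \<Rightarrow> real^'n \<Rightarrow> real"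
  where "ricci g j k x = (\<Sum>i\<in>UNIV. riemann g i k i j x)"

definition scalar_curvature :: "(real^'n::finite \<Rightarrow> real^'n^'n) \<Rightarrow> real^'n \<Rightarrow> real"
  where "scalar_curvature g x =
    (\<Sum>j\<in>UNIV. \<Sum>k\<in>UNIV. matrix_inv (g x) $ j $ k * ricci g j k x)"

definition divergence ::
  "(real^'n::finite \<Rightarrow> real^'n^'n) \<Rightarrow> (real^'n \<Rightarrow> real^'n) \<Rightarrow> real^'n \<Rightarrow> real"
  where "divergence g X x =
    (\<Sum>i\<in>UNIV. partial_deriv i (\<lambda>y. X y $ i) x + (\<Sum>j\<in>UNIV. christoffel g i i j x * X x $ j))"

definition scalar_curvature_X ::
  "real \<Rightarrow> (real^'n::finite \<Rightarrow> real^'n^'n) \<Rightarrow> (real^'n \<Rightarrow> real^'n) \<Rightarrow> real^'n \<Rightarrow> real"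
  where "scalar_curvature_X k g X x =
    scalar_curvature g x + 2 * divergence g X x - (1 + 1/k) * (metric_norm g x (X x))\<^sup>2"

subsection \<open>Asymptotically flat charts\<close>

text \<open>Components of \<open>g\<close> and \<open>X\<close> in the chart \<open>\<phi>\<close> with inverse \<open>\<psi>\<close>, as functions on the image
  of the chart.\<close>

definition chart_metric ::
  "(real^'n::finite \<Rightarrow> real^'n) \<Rightarrow> (real^'n \<Rightarrow> real^'n^'n) \<Rightarrow> real^'n \<Rightarrow> real^'n^'n"
  where "chart_metric \<psi> g y =
    (let J = matrix (frechet_derivative \<psi> (at y)) in transpose J ** g (\<psi> y) ** J)"

definition chart_field ::
  "(real^'n::finite \<Rightarrow> real^'n) \<Rightarrow> (real^'n \<Rightarrow> real^'n) \<Rightarrow> (real^'n \<Rightarrow> real^'n) \<Rightarrow> real^'n \<Rightarrow> real^'n"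
  where "chart_field \<phi> \<psi> X y = frechet_derivative \<phi> (at (\<psi> y)) (X (\<psi> y))"

definition af_chart ::
  "(real^'n::finite \<Rightarrow> real^'n^'n) \<Rightarrow> (real^'n \<Rightarrow> real^'n) \<Rightarrow> (real^'n \<Rightarrow> real^'n) \<Rightarrow> bool"
  where "af_chart g \<phi> \<psi> \<longleftrightarrow>
    (\<exists>K \<rho>. compact K \<and> \<rho> > 0 \<and>
       homeomorphism (- K) (- cball 0 \<rho>) \<phi> \<psi> \<and>
       smooth_on (- K) \<phi> \<and> smooth_on (- cball 0 \<rho>) \<psi>) \<and>
    (\<exists>\<tau>. \<tau> > (real CARD('n) - 2) / 2 \<and>
       (\<forall>i j. bigO2 \<tau> (\<lambda>y. chart_metric \<psi> g y $ i $ j - (if i = j then 1 else 0))))"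

definition asymptotically_flat :: "(real^'n::finite \<Rightarrow> real^'n^'n) \<Rightarrow> bool"
  where "asymptotically_flat g \<longleftrightarrow> (\<exists>\<phi> \<psi>. af_chart g \<phi> \<psi>)"

subsection \<open>The X-ADM mass\<close>

text \<open>Euclidean surface measure on the sphere of radius \<open>r > 0\<close> about the origin: a Borel set
  \<open>A\<close> in the unit sphere has area n times the Lebesgue measure of the cone
  \<open>{t *\<^sub>R a | t a. 0 < t \<le> 1 \<and> a \<in> A}\<close>, and dilation by \<open>r\<close> multiplies areas by \<open>r ^ (n - 1)\<close>.\<close>

definition sphere_measure :: "real \<Rightarrow> (real^'n::finite) measure"
  where "sphere_measure r =
    scale_measure (ennreal (real CARD('n) * r ^ (CARD('n) - 1)))
      (distr (restrict_space lborel (cball 0 1 - {0})) borel (\<lambda>x. (r / norm x) *\<^sub>R x))"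

definition ADM_flux ::
  "(real^'n::finite \<Rightarrow> real^'n^'n) \<Rightarrow> (real^'n \<Rightarrow> real^'n) \<Rightarrow> real \<Rightarrow> real"
  where "ADM_flux h Y r =
    (\<integral>x. (\<Sum>i\<in>UNIV. ((\<Sum>l\<in>UNIV. partial_deriv l (\<lambda>y. h y $ i $ l) x)
                 - (\<Sum>l\<in>UNIV. partial_deriv i (\<lambda>y. h y $ l $ l) x)
                 + 2 * Y x $ i) * (x $ i / norm x))
       \<partial>sphere_measure r)"

text \<open>\<open>m\<close> is the X-ADM mass of \<open>(g, X)\<close>, computed in some asymptotically flat chart.\<close>

definition has_X_ADM_mass ::
  "(real^'n::finite \<Rightarrow> real^'n^'n) \<Rightarrow> (real^'n \<Rightarrow> real^'n) \<Rightarrow> real \<Rightarrow> bool"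
  where "has_X_ADM_mass g X m \<longleftrightarrow>
    (\<exists>\<phi> \<psi>. af_chart g \<phi> \<psi> \<and>
      ((\<lambda>r. 1 / (2 * (real CARD('n) - 1) * measure (sphere_measure 1 :: (real^'n) measure) (sphere 0 1))
            * ADM_flux (chart_metric \<psi> g) (chart_field \<phi> \<psi> X) r) \<longlongrightarrow> m) at_top)"

definition compactly_supported :: "(real^'n::finite \<Rightarrow> real^'n) \<Rightarrow> bool"
  where "compactly_supported X \<longleftrightarrow> compact (closure {x. X x \<noteq> 0})"

end

theory Submission
  imports Defs
begin

text \<open>Let \<open>h = u^(4/(n-2)) \<delta>\<close> be flat near the origin and negative mass Schwarzschild outside a ball, so
  that its scalar curvature is negative only on an annulus. For \<open>g = exp (-2w) h\<close> and \<open>X\<close> the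
  \<open>g\<close>-gradient of \<open>-(n-1) w\<close> the conformal change formula gives
  \<open>R_X^(k) = exp (2w) (R(h) + c |dw|^2)\<close>, where \<open>|dw|\<close> is taken in \<open>h\<close> and
  \<open>c = (n-1)(n-2) - (1 + 1/k) (n-1)^2\<close>; for negative \<open>k\<close>, \<open>c > 0\<close> is exactly the condition \<open>k > 1-n\<close>. Hence a
  compactly supported \<open>w\<close> with large gradient on the annulus makes \<open>R_X^(k)\<close> nonnegative, while the
  mass remains that of \<open>h\<close>.\<close>

subsection \<open>Completeness of uniformly Euclidean metrics\<close>

text \<open>With \<open>X = 0\<close> the positive mass theorem rules out a negative mass, so the
  square of \<open>dw\<close> has to do all the work. It can pay for negative curvature only where
  \<open>dw\<close> is nonzero, and the differential of a radial function vanishes at the origin.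
  This is why h is made flat there; the same modification removes the singularity of the negative
  mass Schwarzschild metric at the zero of \<open>u\<close>. The multiple \<open>-(n-1)\<close> of
  \<open>w\<close> is dictated by cancellation: the Laplacian of \<open>w\<close> enters the scalar
  curvature and twice the divergence with opposite coefficients. Such a term has no sign and could
  not be controlled otherwise. Scaling \<open>w\<close> by a constant \<open>A\<close> multiplies
  the gain by \<open>A^2\<close> and leaves the curvature of h as it is. Hence no sharp curvature
  estimate is required on the annulus; a bound from compactness is enough. All profiles are
  functions of t = \<open>x \<bullet> x\<close> instead of the norm, which makes smoothness at the
  origin automatic. Thresholds for t are therefore squared radii, and r^(2-n) becomes
  t^(1-n/2).\<close>

lemma metric_norm_scaleR: "metric_norm g x (c *\<^sub>R v) = \<bar>c\<bar> * metric_norm g x v"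
proof -
  have "(c *\<^sub>R v) \<bullet> (g x *v (c *\<^sub>R v)) = c\<^sup>2 * (v \<bullet> (g x *v v))"
    by (simp add: matrix_vector_mult_scaleR power2_eq_square)
  then show ?thesis
    by (simp add: metric_norm_def real_sqrt_mult)
qed

text \<open>Reversal changes the sign of the velocity, which the norm does not see. Only finitely
  many parameters lack a derivative, and they do not affect the integral.\<close>

lemma has_integral_speed_reversepath:
  assumes \<gamma>: "valid_path \<gamma>" and i: "(speed g \<gamma> has_integral i) {0..1}"
  shows "(speed g (reversepath \<gamma>) has_integral i) {0..1}"
proof -
  obtain S where S: "finite S" "\<forall>x\<in>{0..1} - S. \<gamma> differentiable at x"
    using \<gamma> by (auto simp: valid_path_def piecewise_C1_differentiable_on_def C1_differentiable_on_eq)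
  have eq: "speed g (reversepath \<gamma>) x = speed g \<gamma> (1 - x)" if "x \<in> {0..1} - (-) 1 ` S" for x
  proof -
    have "1 - x \<in> {0..1} - S"
      using that by (force simp: image_iff)
    then have "(\<gamma> has_vector_derivative vector_derivative \<gamma> (at (1 - x))) (at (1 - x))"
      using S by (simp add: vector_derivative_works)
    moreover have "((\<lambda>x. 1 - x) has_vector_derivative -1) (at x)"
      by (auto intro!: derivative_eq_intros)
    ultimately have "(\<gamma> \<circ> (\<lambda>x. 1 - x) has_vector_derivative -1 *\<^sub>R vector_derivative \<gamma> (at (1 - x))) (at x)"
      by (intro vector_diff_chain_at)
    then have "vector_derivative (reversepath \<gamma>) (at x) = -1 *\<^sub>R vector_derivative \<gamma> (at (1 - x))"
      by (intro vector_derivative_at) (simp add: o_def reversepath_def)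
    then show ?thesis
      unfolding speed_def by (simp only: metric_norm_scaleR) (simp add: reversepath_def)
  qed
  have "((\<lambda>x. speed g \<gamma> (1 - x)) has_integral i) {0..1}"
    using has_integral_affinity01 [where m= "-1" and c=1, OF i] by simp
  then show ?thesis
    by (rule has_integral_spike_finite [of "(-) 1 ` S", rotated 2]) (use S eq in auto)
qed

text \<open>Each half is traversed at twice the speed on half the interval, so both lengths are
  unchanged. The breakpoint 1/2 joins the preimages of the exceptional parameters in the finite sets
  to be ignored.\<close>

lemma has_integral_speed_join:
  assumes g1: "valid_path g1" and i1: "(speed g g1 has_integral i1) {0..1}"
    and g2: "valid_path g2" and i2: "(speed g g2 has_integral i2) {0..1}"
  shows "(speed g (g1 +++ g2) has_integral i1 + i2) {0..1}"
proof -
  obtain s1 s2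
    where s1: "finite s1" "\<forall>x\<in>{0..1} - s1. g1 differentiable at x"
      and s2: "finite s2" "\<forall>x\<in>{0..1} - s2. g2 differentiable at x"
    using g1 g2
    by (auto simp: valid_path_def piecewise_C1_differentiable_on_def C1_differentiable_on_eq)
  have j1: "((\<lambda>x. 2 * speed g g1 (2*x)) has_integral i1) {0..1/2}"
    and j2: "((\<lambda>x. 2 * speed g g2 (2*x - 1)) has_integral i2) {1/2..1}"
    using has_integral_affinity01 [OF i1, where m= 2 and c=0, THEN has_integral_cmul [where c=2]]
          has_integral_affinity01 [OF i2, where m= 2 and c="-1", THEN has_integral_cmul [where c=2]]
    by (simp_all only: image_affinity_atLeastAtMost_div_diff, simp_all)
  have e1: "speed g (g1 +++ g2) z = 2 * speed g g1 (2 * z)"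
    if z: "0 \<le> z" "z < 1/2" "2 * z \<notin> s1" for z
  proof -
    have "(g1 has_vector_derivative vector_derivative g1 (at (2 * z))) (at (2 * z))"
      using s1 z by (auto simp: vector_derivative_works)
    moreover have "((\<lambda>z. 2 * z) has_vector_derivative 2) (at z)"
      by (auto intro!: derivative_eq_intros)
    ultimately have "((\<lambda>z. g1 (2 * z)) has_vector_derivative 2 *\<^sub>R vector_derivative g1 (at (2 * z))) (at z)"
      by (intro vector_diff_chain_at [simplified o_def])
    then have "((g1 +++ g2) has_vector_derivative 2 *\<^sub>R vector_derivative g1 (at (2 * z))) (at z)"
      by (rule has_vector_derivative_transform_within [where d = "\<bar>z - 1/2\<bar>"])
         (use z in \<open>auto simp: joinpaths_def dist_real_def abs_if split: if_split_asm\<close>)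
    then have "vector_derivative (g1 +++ g2) (at z) = 2 *\<^sub>R vector_derivative g1 (at (2 * z))"
      by (rule vector_derivative_at)
    then show ?thesis
      unfolding speed_def using z by (simp only: metric_norm_scaleR) (simp add: joinpaths_def)
  qed
  have e2: "speed g (g1 +++ g2) z = 2 * speed g g2 (2 * z - 1)"
    if z: "1/2 < z" "z \<le> 1" "2 * z - 1 \<notin> s2" for z
  proof -
    have "(g2 has_vector_derivative vector_derivative g2 (at (2 * z - 1))) (at (2 * z - 1))"
      using s2 z by (auto simp: vector_derivative_works)
    moreover have "((\<lambda>z. 2 * z - 1) has_vector_derivative 2) (at z)"
      by (auto intro!: derivative_eq_intros)
    ultimately have "((\<lambda>z. g2 (2 * z - 1)) has_vector_derivative 2 *\<^sub>R vector_derivative g2 (at (2 * z - 1))) (at z)"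
      by (intro vector_diff_chain_at [simplified o_def])
    then have "((g1 +++ g2) has_vector_derivative 2 *\<^sub>R vector_derivative g2 (at (2 * z - 1))) (at z)"
      by (rule has_vector_derivative_transform_within [where d = "\<bar>z - 1/2\<bar>"])
         (use z in \<open>auto simp: joinpaths_def dist_real_def abs_if split: if_split_asm\<close>)
    then have "vector_derivative (g1 +++ g2) (at z) = 2 *\<^sub>R vector_derivative g2 (at (2 * z - 1))"
      by (rule vector_derivative_at)
    then show ?thesis
      unfolding speed_def using z by (simp only: metric_norm_scaleR) (simp add: joinpaths_def)
  qed
  have "(speed g (g1 +++ g2) has_integral i1) {0..1/2}"
  proof (rule has_integral_spike_finite [OF _ _ j1])
    show "finite (insert (1/2) ((*) 2 -` s1))"
      using s1 by (force intro: finite_vimageI [where h = "(*)2"] inj_onI)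
  qed (auto simp: e1)
  moreover have "(speed g (g1 +++ g2) has_integral i2) {1/2..1}"
  proof (rule has_integral_spike_finite [OF _ _ j2])
    show "finite (insert (1/2) ((\<lambda>x. 2 * x - 1) -` s2))"
      using s2 by (force intro: finite_vimageI [where h = "\<lambda>x. 2*x-1"] inj_onI)
  qed (auto simp: e2)
  ultimately show ?thesis
    by (simp add: has_integral_combine [where c = "1/2"])
qed

text \<open>Lengths are values of \<open>has_integral\<close> rather than \<open>integral\<close>,
  so that integrability travels with the number when paths are reversed or joined.\<close>

definition path_lengths :: "(real^'n::finite \<Rightarrow> real^'n^'n) \<Rightarrow> real^'n \<Rightarrow> real^'n \<Rightarrow> real set"
  where "path_lengths g x y = {l. \<exists>\<gamma>. valid_path \<gamma> \<and> (speed g \<gamma> has_integral l) {0..1}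
    \<and> pathstart \<gamma> = x \<and> pathfinish \<gamma> = y}"

lemma riem_dist_eq_Inf_path_lengths: "riem_dist g x y = Inf (path_lengths g x y)"
  unfolding riem_dist_def path_lengths_def
  by (rule arg_cong[of _ _ Inf]) (auto simp: has_integral_iff)

lemma path_lengths_commute: "path_lengths g x y = path_lengths g y x"
proof -
  have "path_lengths g x y \<subseteq> path_lengths g y x" for x y
  proof
    fix l assume "l \<in> path_lengths g x y"
    then obtain \<gamma> where "valid_path \<gamma>" "(speed g \<gamma> has_integral l) {0..1}"
      "pathstart \<gamma> = x" "pathfinish \<gamma> = y"
      unfolding path_lengths_def by blast
    then show "l \<in> path_lengths g y x"
      unfolding path_lengths_def using has_integral_speed_reversepath[of \<gamma>]
      by (intro CollectI exI[of _ "reversepath \<gamma>"]) (simp add: valid_path_imp_reverse)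
  qed
  then show ?thesis by blast
qed

lemma path_lengths_add:
  assumes "a \<in> path_lengths g x y" "b \<in> path_lengths g y z"
  shows "a + b \<in> path_lengths g x z"
proof -
  obtain \<gamma> \<delta> where
    "valid_path \<gamma>" "(speed g \<gamma> has_integral a) {0..1}" "pathstart \<gamma> = x" "pathfinish \<gamma> = y"
    "valid_path \<delta>" "(speed g \<delta> has_integral b) {0..1}" "pathstart \<delta> = y" "pathfinish \<delta> = z"
    using assms unfolding path_lengths_def by blast
  then show ?thesis
    unfolding path_lengths_def
    by (intro CollectI exI[of _ "\<gamma> +++ \<delta>"])
       (simp add: has_integral_speed_join valid_path_join)
qed

text \<open>The displacement is the integral of the velocity, by the fundamental theorem of calculus
  off a finite set, and its norm is at most the integral of the speed divided by
  \<open>a\<close>.\<close>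

lemma path_lengths_ge:
  assumes lower: "\<And>x v. a * norm v \<le> metric_norm g x v" and "a > 0"
    and l: "l \<in> path_lengths g x y"
  shows "a * norm (y - x) \<le> l"
proof -
  obtain \<gamma> where \<gamma>: "valid_path \<gamma>" "(speed g \<gamma> has_integral l) {0..1}" "\<gamma> 0 = x" "\<gamma> 1 = y"
    using l unfolding path_lengths_def pathstart_def pathfinish_def by blast
  obtain S where S: "continuous_on {0..1} \<gamma>" "finite S" "\<forall>x\<in>{0..1} - S. \<gamma> differentiable at x"
    using \<gamma> by (auto simp: valid_path_def piecewise_C1_differentiable_on_def C1_differentiable_on_eq)
  have "((\<lambda>t. vector_derivative \<gamma> (at t)) has_integral (\<gamma> 1 - \<gamma> 0)) {0..1}"
    using S
    by (intro fundamental_theorem_of_calculus_interior_strong[of S])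
       (auto simp: vector_derivative_works[symmetric])
  moreover have "((\<lambda>t. speed g \<gamma> t / a) has_integral l / a) {0..1}"
    using has_integral_mult_left[OF \<gamma>(2), of "1/a"] by simp
  \<comment> \<open>The inner product with 1 is the real-valued instance of the component that the
    integral bound below asks for.\<close>
  moreover have "norm (vector_derivative \<gamma> (at t)) \<le> (speed g \<gamma> t / a) \<bullet> 1" for t
    using lower[of "vector_derivative \<gamma> (at t)" "\<gamma> t"] \<open>a > 0\<close>
    by (simp add: speed_def field_simps)
  ultimately have "norm (\<gamma> 1 - \<gamma> 0) \<le> (l / a) \<bullet> 1"
    by (rule has_integral_norm_bound_integral_component)
  then show ?thesis
    using \<open>a > 0\<close> \<gamma> by (simp add: field_simps)
qed

text \<open>The straight segment has constant velocity. It also witnesses that the set of lengths is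
  nonempty, which every argument about its infimum needs.\<close>

lemma path_lengths_linepath_le:
  assumes g: "continuous_on UNIV g"
    and upper: "\<And>x v. metric_norm g x v \<le> b * norm v"
  obtains l where "l \<in> path_lengths g x y" "l \<le> b * norm (y - x)"
proof -
  have "continuous_on {0..1} (\<lambda>t. g (linepath x y t))"
    by (intro continuous_on_compose2[OF g]) (auto intro!: continuous_intros simp: linepath_def)
  then have "continuous_on {0..1} (speed g (linepath x y))"
    unfolding speed_def metric_norm_def vector_derivative_linepath_at
      matrix_vector_mult_def inner_vec_def
    by (intro continuous_intros) auto
  then have i: "(speed g (linepath x y) has_integral integral {0..1} (speed g (linepath x y))) {0..1}"
    by (intro integrable_integral integrable_continuous_interval)
  have "integral {0..1} (speed g (linepath x y)) \<le> b * norm (y - x)"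
    using has_integral_le[OF i has_integral_const_real[of "b * norm (y - x)"]] upper
    by (simp add: speed_def)
  moreover have "integral {0..1} (speed g (linepath x y)) \<in> path_lengths g x y"
    unfolding path_lengths_def using i
    by (intro CollectI exI[of _ "linepath x y"]) auto
  ultimately show ?thesis
    using that by blast
qed

text \<open>The Riemannian distance lies between \<open>a\<close> and \<open>b\<close> times the
  Euclidean one: the lower bound turns its Cauchy sequences into Euclidean ones, the upper bound
  carries Euclidean limits back.\<close>

theorem complete_metric_if_uniformly_equivalent:
  fixes g :: "real^'n::finite \<Rightarrow> real^'n^'n"
  assumes g: "continuous_on UNIV g" and a: "a > 0"
    and lower: "\<And>x v. a * norm v \<le> metric_norm g x v"
    and upper: "\<And>x v. metric_norm g x v \<le> b * norm v"
  shows "complete_metric g"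
proof -
  note ge = path_lengths_ge[OF lower a]
  have bdd: "bdd_below (path_lengths g x y)" for x y
    using ge by (intro bdd_belowI)
  have ne: "path_lengths g x y \<noteq> {}" for x y
    using path_lengths_linepath_le[OF g upper, of x y] by blast
  have d_ge: "a * dist x y \<le> riem_dist g x y" for x y
    unfolding riem_dist_eq_Inf_path_lengths
    using cInf_greatest[OF ne ge] by (simp add: dist_norm norm_minus_commute)
  have d_le: "riem_dist g x y \<le> b * dist x y" for x y
  proof -
    obtain l where "l \<in> path_lengths g x y" "l \<le> b * norm (y - x)"
      using path_lengths_linepath_le[OF g upper] by blast
    then show ?thesis
      unfolding riem_dist_eq_Inf_path_lengths
      using cInf_lower[OF _ bdd] by (fastforce simp: dist_norm norm_minus_commute)
  qed
  have tri: "riem_dist g x z \<le> riem_dist g x y + riem_dist g y z" for x y z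
  proof -
    \<comment> \<open>The two infima are taken one at a time: \<open>q\<close> is fixed while
      \<open>p\<close> varies, then \<open>q\<close> varies.\<close>
    have "riem_dist g x z - q \<le> riem_dist g x y" if q: "q \<in> path_lengths g y z" for q
      unfolding riem_dist_eq_Inf_path_lengths[of g x y]
    proof (rule cInf_greatest[OF ne])
      fix p assume "p \<in> path_lengths g x y"
      then show "riem_dist g x z - q \<le> p"
        unfolding riem_dist_eq_Inf_path_lengths
        using cInf_lower[OF path_lengths_add[OF _ q] bdd] by fastforce
    qed
    then have "riem_dist g x z - riem_dist g x y \<le> riem_dist g y z"
      unfolding riem_dist_eq_Inf_path_lengths[of g y z]
      by (intro cInf_greatest[OF ne]) fastforce
    then show ?thesis by simp
  qed
  have M: "Metric_space UNIV (riem_dist g)"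
  proof
    fix x y z :: "real^'n"
    show "0 \<le> riem_dist g x y"
      using d_ge[of x y] a by (meson order_trans zero_le_dist zero_le_mult_iff less_imp_le)
    show "riem_dist g x y = riem_dist g y x"
      by (simp add: riem_dist_eq_Inf_path_lengths path_lengths_commute)
    show "riem_dist g x y = 0 \<longleftrightarrow> x = y"
    proof
      assume "riem_dist g x y = 0"
      then have "a * dist x y \<le> 0" using d_ge[of x y] by simp
      then show "x = y" using a by (simp add: mult_le_0_iff)
    next
      assume "x = y"
      then show "riem_dist g x y = 0" using d_ge[of x y] d_le[of x y] by simp
    qed
    show "riem_dist g x z \<le> riem_dist g x y + riem_dist g y z" by (rule tri)
  qed
  then interpret Metric_space UNIV "riem_dist g" .
  have "mcomplete"
    unfolding mcomplete_def
  proof (intro allI impI)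
    fix \<sigma> assume \<sigma>: "MCauchy \<sigma>"
    have "Cauchy \<sigma>"
      unfolding Cauchy_def
    proof (intro allI impI)
      fix e :: real assume "e > 0"
      then obtain N where "\<And>m n. N \<le> m \<Longrightarrow> N \<le> n \<Longrightarrow> riem_dist g (\<sigma> m) (\<sigma> n) < a * e"
        using \<sigma> a unfolding MCauchy_def by (metis mult_pos_pos)
      then have "a * dist (\<sigma> m) (\<sigma> n) < a * e" if "N \<le> m" "N \<le> n" for m n
        using d_ge that by (meson le_less_trans)
      then show "\<exists>M. \<forall>m\<ge>M. \<forall>n\<ge>M. dist (\<sigma> m) (\<sigma> n) < e"
        using a by auto
    qed
    then obtain x where x: "\<sigma> \<longlonglongrightarrow> x"
      by (auto simp: Cauchy_convergent_iff convergent_def)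
    then have "(\<lambda>n. b * dist (\<sigma> n) x) \<longlonglongrightarrow> b * 0"
      by (intro tendsto_intros) (simp add: tendsto_dist_iff[symmetric])
    then have "(\<lambda>n. b * dist (\<sigma> n) x) \<longlonglongrightarrow> 0" by simp
    then have "(\<lambda>n. riem_dist g (\<sigma> n) x) \<longlonglongrightarrow> 0"
      by (rule tendsto_sandwich[OF _ _ tendsto_const, rotated 2]) (auto simp: d_le)
    then have "limitin mtopology \<sigma> x sequentially"
      by (simp add: limit_metric_sequentially LIMSEQ_iff)
    then show "\<exists>x. limitin mtopology \<sigma> x sequentially" ..
  qed
  then show ?thesis
    by (simp add: complete_metric_def)
qed

subsection \<open>Smooth real functions\<close>

text \<open>The class is closed under differentiation, which yields derivatives of all orders without any
  higher-order product or chain rule. The rule \<open>flat\<close> with its powers of \<open>1/t\<close> collects what occurs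
  in the derivatives of \<open>exp (-1/t)\<close>.\<close>

inductive_set smooth_real :: "(real \<Rightarrow> real) set" where
  const: "(\<lambda>t. c) \<in> smooth_real"
| id: "(\<lambda>t. t) \<in> smooth_real"
| flat: "(\<lambda>t. if t \<le> 0 then 0 else inverse t ^ m * exp (- inverse t)) \<in> smooth_real"
| add: "a \<in> smooth_real \<Longrightarrow> b \<in> smooth_real \<Longrightarrow> (\<lambda>t. a t + b t) \<in> smooth_real"
| mult: "a \<in> smooth_real \<Longrightarrow> b \<in> smooth_real \<Longrightarrow> (\<lambda>t. a t * b t) \<in> smooth_real"
| comp: "a \<in> smooth_real \<Longrightarrow> b \<in> smooth_real \<Longrightarrow> (\<lambda>t. a (b t)) \<in> smooth_real"
| exp: "a \<in> smooth_real \<Longrightarrow> (\<lambda>t. exp (a t)) \<in> smooth_real"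
| inverse: "a \<in> smooth_real \<Longrightarrow> (\<And>t. a t \<noteq> 0) \<Longrightarrow> (\<lambda>t. inverse (a t)) \<in> smooth_real"
| ln: "a \<in> smooth_real \<Longrightarrow> (\<And>t. a t > 0) \<Longrightarrow> (\<lambda>t. ln (a t)) \<in> smooth_real"

text \<open>Away from 0 this is calculus. At 0 the difference quotient vanishes on the left, while
  on the right it is s^(m+1) / exp s with s = 1/t, which tends to 0.\<close>

lemma flat_has_derivative:
  "((\<lambda>t. if t \<le> 0 then 0 else inverse t ^ m * exp (- inverse t)) has_real_derivative
    (if t \<le> 0 then 0 else inverse t ^ (m + 2) * exp (- inverse t))
    - real m * (if t \<le> 0 then 0 else inverse t ^ (m + 1) * exp (- inverse t))) (at t)"
  (is "(?h has_real_derivative _) _")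
proof (cases t "0 :: real" rule: linorder_cases)
  case less
  have "((\<lambda>t. 0) has_real_derivative 0) (at t)" by simp
  then have "(?h has_real_derivative 0) (at t)"
    by (rule has_field_derivative_transform_within_open[of _ _ _ "{..<0}"]) (use less in auto)
  then show ?thesis using less by simp
next
  case greater
  have inv: "(inverse has_real_derivative - (inverse t ^ 2)) (at t)"
    using DERIV_inverse[of t] greater by (simp add: power_inverse power2_eq_square)
  have pow: "((\<lambda>t. inverse t ^ m) has_real_derivative - real m * inverse t ^ (m + 1)) (at t)"
  \<comment> \<open>The power rule involves the exponent \<open>m - 1\<close>, which is truncated
    for \<open>m = 0\<close>.\<close>
  proof (cases m)
    case (Suc k)
    then show ?thesis
      using DERIV_power[OF inv, of m] by (simp add: power2_eq_square algebra_simps)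
  qed simp
  have "((\<lambda>t. exp (- inverse t)) has_real_derivative exp (- inverse t) * - (- (inverse t ^ 2))) (at t)"
    by (intro DERIV_fun_exp DERIV_minus inv)
  from DERIV_mult[OF pow this]
  have "((\<lambda>t. inverse t ^ m * exp (- inverse t)) has_real_derivative
     inverse t ^ (m + 2) * exp (- inverse t) - real m * (inverse t ^ (m + 1) * exp (- inverse t))) (at t)"
    by (rule DERIV_cong) (simp add: power2_eq_square algebra_simps)
  then have "(?h has_real_derivative
     inverse t ^ (m + 2) * exp (- inverse t) - real m * (inverse t ^ (m + 1) * exp (- inverse t))) (at t)"
    by (rule has_field_derivative_transform_within_open[of _ _ _ "{0<..}"]) (use greater in auto)
  then show ?thesis using greater by simp
next
  case equal
  have "((\<lambda>s::real. s ^ (m + 1) / exp s) \<longlongrightarrow> 0) at_top"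
    by (rule tendsto_power_div_exp_0)
  then have "((\<lambda>s::real. inverse s ^ (m + 1) / exp (inverse s)) \<longlongrightarrow> 0) (at_right 0)"
    by (rule filterlim_compose[OF _ filterlim_inverse_at_top_right])
  then have "((\<lambda>s. ?h s / s) \<longlongrightarrow> 0) (at_right 0)"
    by (rule Lim_transform_eventually)
       (auto simp: eventually_at_right_field exp_minus divide_simps intro!: exI[of _ 1])
  moreover have "((\<lambda>s. ?h s / s) \<longlongrightarrow> 0) (at_left 0)"
    by (rule Lim_transform_eventually[OF tendsto_const])
       (auto simp: eventually_at_left_field intro!: exI[of _ "-1"])
  ultimately have "((\<lambda>s. ?h s / s) \<longlongrightarrow> 0) (at 0)"
    by (rule filterlim_split_at[rotated])
  then show ?thesis
    using equal by (simp add: has_field_derivative_iff)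
qed

theorem smooth_real_has_derivative:
  assumes "a \<in> smooth_real"
  obtains a' where "a' \<in> smooth_real" "\<And>t. (a has_real_derivative a' t) (at t)"
proof -
  have "\<exists>a'. a' \<in> smooth_real \<and> (\<forall>t. (a has_real_derivative a' t) (at t))"
    using assms
  proof induction
    case (const c)
    show ?case by (intro exI[of _ "\<lambda>t. 0"]) (auto intro: smooth_real.intros)
  next
    case id
    show ?case by (intro exI[of _ "\<lambda>t. 1"]) (auto intro: smooth_real.intros)
  next
    case (flat m)
    have "(\<lambda>t. (if t \<le> 0 then 0 else inverse t ^ (m + 2) * exp (- inverse t))
       + (- real m) * (if t \<le> 0 then 0 else inverse t ^ (m + 1) * exp (- inverse t))) \<in> smooth_real"
      by (intro smooth_real.intros)
    then show ?case
      using flat_has_derivative[of m] by (intro exI conjI) (assumption, simp)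
  next
    case (add a b)
    then obtain a' b' where "a' \<in> smooth_real" "\<And>t. (a has_real_derivative a' t) (at t)"
      "b' \<in> smooth_real" "\<And>t. (b has_real_derivative b' t) (at t)" by blast
    then show ?case
      by (intro exI[of _ "\<lambda>t. a' t + b' t"] conjI allI DERIV_add smooth_real.add)
  next
    case (mult a b)
    then obtain a' b' where "a' \<in> smooth_real" "\<And>t. (a has_real_derivative a' t) (at t)"
      "b' \<in> smooth_real" "\<And>t. (b has_real_derivative b' t) (at t)" by blast
    then show ?case using mult.hyps
      by (intro exI[of _ "\<lambda>t. a' t * b t + b' t * a t"] conjI smooth_real.add smooth_real.mult
          allI DERIV_mult)
  next
    case (comp a b)
    then obtain a' b' where "a' \<in> smooth_real" "\<And>t. (a has_real_derivative a' t) (at t)"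
      "b' \<in> smooth_real" "\<And>t. (b has_real_derivative b' t) (at t)" by blast
    moreover from this have "(\<lambda>t. a' (b t) * b' t) \<in> smooth_real"
      using smooth_real.comp[of a' b] comp.hyps by (intro smooth_real.mult)
    ultimately show ?case
      by (intro exI[of _ "\<lambda>t. a' (b t) * b' t"] conjI allI DERIV_chain2)
  next
    case (exp a)
    then obtain a' where "a' \<in> smooth_real" "\<And>t. (a has_real_derivative a' t) (at t)" by blast
    then show ?case using exp.hyps
      by (intro exI[of _ "\<lambda>t. exp (a t) * a' t"] conjI allI DERIV_fun_exp smooth_real.mult
          smooth_real.exp)
  next
    case (inverse a)
    then obtain a' where a': "a' \<in> smooth_real" "\<And>t. (a has_real_derivative a' t) (at t)" by blast
    have "(\<lambda>t. (-1) * (a' t * (inverse (a t) * inverse (a t)))) \<in> smooth_real"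
      using a' inverse.hyps by (intro smooth_real.mult smooth_real.inverse smooth_real.const) auto
    moreover have "((\<lambda>t. inverse (a t)) has_real_derivative
        (-1) * (a' t * (inverse (a t) * inverse (a t)))) (at t)" for t
      using DERIV_inverse'[OF a'(2)[of t] inverse.hyps(2)] by (simp add: ac_simps)
    ultimately show ?case by blast
  next
    case (ln a)
    then obtain a' where a': "a' \<in> smooth_real" "\<And>t. (a has_real_derivative a' t) (at t)" by blast
    have "(\<lambda>t. inverse (a t) * a' t) \<in> smooth_real"
      using a' ln.hyps by (intro smooth_real.mult smooth_real.inverse) (auto simp: less_imp_neq[symmetric] dest: less_imp_neq)
    moreover have "((\<lambda>t. ln (a t)) has_real_derivative inverse (a t) * a' t) (at t)" for t
      using ln.hyps(2)[of t] a'(2)[of t] by (auto intro!: derivative_eq_intros simp: field_simps)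
    ultimately show ?case by blast
  qed
  then show ?thesis using that by blast
qed

lemma smooth_real_continuous: "a \<in> smooth_real \<Longrightarrow> continuous_on UNIV a"
  by (metis smooth_real_has_derivative DERIV_isCont continuous_at_imp_continuous_on)

lemma smooth_real_cmult: "a \<in> smooth_real \<Longrightarrow> (\<lambda>t. c * a t) \<in> smooth_real"
  by (intro smooth_real.mult smooth_real.const)

lemma smooth_real_diff: "a \<in> smooth_real \<Longrightarrow> b \<in> smooth_real \<Longrightarrow> (\<lambda>t. a t - b t) \<in> smooth_real"
  using smooth_real.add[OF _ smooth_real_cmult[of b "-1"], of a] by simp

lemma smooth_real_powr:
  assumes "a \<in> smooth_real" "\<And>t. a t > 0"
  shows "(\<lambda>t. a t powr p) \<in> smooth_real"
proof -
  have "a t \<noteq> 0" for t using assms(2)[of t] by simp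
  then have "(\<lambda>t. a t powr p) = (\<lambda>t. exp (p * ln (a t)))"
    by (auto simp: powr_def)
  then show ?thesis
    using assms by (simp add: smooth_real.exp smooth_real_cmult smooth_real.ln)
qed

text \<open>The standard quotient h(t-1) / (h(t-1) + h(2-t)), with h(t) = exp (-1/t) for positive t
  and 0 otherwise. Its denominator is positive because t > 1 or t < 2.\<close>

lemma smooth_step_exists:
  obtains H where "H \<in> smooth_real" "\<And>t. t \<le> 1 \<Longrightarrow> H t = 0" "\<And>t. t \<ge> 2 \<Longrightarrow> H t = 1"
    "\<And>t. 0 \<le> H t" "\<And>t. H t \<le> 1"
proof -
  \<comment> \<open>The trivial factor \<open>inverse t ^ 0\<close> makes \<open>h\<close> literally
    an instance of the rule \<open>flat\<close>.\<close>
  define h where "h = (\<lambda>t::real. if t \<le> 0 then 0 else inverse t ^ 0 * exp (- inverse t))"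
  define H where "H = (\<lambda>t. h (t - 1) * inverse (h (t - 1) + h (2 - t)))"
  have h: "h \<in> smooth_real"
    unfolding h_def by (rule smooth_real.flat)
  have h_nonneg: "h t \<ge> 0" and h_pos: "t > 0 \<Longrightarrow> h t > 0" and h_0: "t \<le> 0 \<Longrightarrow> h t = 0" for t
    by (auto simp: h_def)
  have pos: "h (t - 1) + h (2 - t) > 0" for t
    using h_nonneg[of "t - 1"] h_nonneg[of "2 - t"] h_pos[of "t - 1"] h_pos[of "2 - t"]
    by (cases "t > 1") linarith+
  have 1: "(\<lambda>t. h (t - 1)) \<in> smooth_real" and 2: "(\<lambda>t. h (2 - t)) \<in> smooth_real"
    by (intro smooth_real.comp[OF h] smooth_real_diff smooth_real.const smooth_real.id)+
  have "H \<in> smooth_real"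
    unfolding H_def using pos
    by (intro smooth_real.mult smooth_real.inverse smooth_real.add 1 2) (simp add: less_imp_neq[symmetric])
  moreover have "H t = 0" if "t \<le> 1" for t
    using that by (simp add: H_def h_0)
  moreover have "H t = 1" if "t \<ge> 2" for t
    using that pos[of t] by (simp add: H_def h_0)
  moreover have "0 \<le> H t" "H t \<le> 1" for t
    using pos[of t] h_nonneg[of "t - 1"] h_nonneg[of "2 - t"] by (auto simp: H_def field_simps)
  ultimately show ?thesis using that by blast
qed

subsection \<open>Smooth functions on Euclidean space\<close>

lemma partial_deriv_eqI: "(f has_derivative f') (at x) \<Longrightarrow> partial_deriv i f x = f' (axis i 1)"
  unfolding partial_deriv_def by (drule frechet_derivative_at) simp

lemma partial_deriv_const [simp]: "partial_deriv i (\<lambda>x. c) = (\<lambda>x. 0)"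
  by (rule ext, subst partial_deriv_eqI[of _ "\<lambda>_. 0"]) auto

lemma iter_partial_zero [simp]: "iter_partial is (\<lambda>x. 0) = (\<lambda>x. 0)"
  by (induction "is") auto

text \<open>An algebra closed under partial derivatives, because the i-th partial derivative of a(x
  \<bullet> x) is 2 a'(x \<bullet> x) times the i-th coordinate. Smoothness of its members then
  needs only differentiability of each of them.\<close>

inductive_set radial_algebra :: "(real^'n::finite \<Rightarrow> real) set" where
  coord: "(\<lambda>x. x $ i) \<in> radial_algebra"
| radial: "a \<in> smooth_real \<Longrightarrow> (\<lambda>x. a (x \<bullet> x)) \<in> radial_algebra"
| add: "f \<in> radial_algebra \<Longrightarrow> h \<in> radial_algebra \<Longrightarrow> (\<lambda>x. f x + h x) \<in> radial_algebra"
| mult: "f \<in> radial_algebra \<Longrightarrow> h \<in> radial_algebra \<Longrightarrow> (\<lambda>x. f x * h x) \<in> radial_algebra"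

lemma radial_algebra_const: "(\<lambda>x. c) \<in> radial_algebra"
  using radial_algebra.radial[OF smooth_real.const] .

lemma has_derivative_radial:
  assumes "(a has_real_derivative a') (at (x \<bullet> x))"
  shows "((\<lambda>x::real^'n. a (x \<bullet> x)) has_derivative (\<lambda>v. 2 * a' * (x \<bullet> v))) (at x)"
proof -
  have "((\<lambda>x::real^'n. x \<bullet> x) has_derivative (\<lambda>v. 2 * (x \<bullet> v))) (at x)"
    by (auto intro!: derivative_eq_intros simp: inner_commute)
  from has_derivative_compose[OF this] assms show ?thesis
    by (force simp: has_field_derivative_def mult_ac)
qed

lemma partial_deriv_radial:
  assumes "(a has_real_derivative a') (at (x \<bullet> x))"
  shows "partial_deriv i (\<lambda>x. a (x \<bullet> x)) x = 2 * a' * x $ i"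
  using partial_deriv_eqI[OF has_derivative_radial[OF assms]] by (simp add: inner_axis)

lemma has_derivative_coord: "((\<lambda>x::real^'n. x $ i) has_derivative (\<lambda>v. v $ i)) (at x)"
  by (simp add: bounded_linear_imp_has_derivative bounded_linear_vec_nth)

lemma partial_deriv_coord: "partial_deriv j (\<lambda>x::real^'n::finite. x $ i) x = (if i = j then 1 else 0)"
  by (simp add: partial_deriv_eqI[OF has_derivative_coord] axis_def)

lemma partial_deriv_mult:
  fixes f h :: "real^'n::finite \<Rightarrow> real"
  assumes "f differentiable at x" "h differentiable at x"
  shows "partial_deriv i (\<lambda>x. f x * h x) x = partial_deriv i f x * h x + f x * partial_deriv i h x"
proof -
  have f: "(f has_derivative frechet_derivative f (at x)) (at x)"
    and h: "(h has_derivative frechet_derivative h (at x)) (at x)"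
    using assms by (simp_all add: frechet_derivative_works)
  show ?thesis
    using partial_deriv_eqI[OF has_derivative_mult[OF f h]] by (simp add: partial_deriv_def)
qed

lemma partial_deriv_add:
  fixes f h :: "real^'n::finite \<Rightarrow> 'b::real_normed_vector"
  assumes "f differentiable at x" "h differentiable at x"
  shows "partial_deriv i (\<lambda>x. f x + h x) x = partial_deriv i f x + partial_deriv i h x"
proof -
  have f: "(f has_derivative frechet_derivative f (at x)) (at x)"
    and h: "(h has_derivative frechet_derivative h (at x)) (at x)"
    using assms by (simp_all add: frechet_derivative_works)
  show ?thesis
    using partial_deriv_eqI[OF has_derivative_add[OF f h]] by (simp add: partial_deriv_def)
qed

lemma partial_deriv_linear_comp:
  assumes "bounded_linear L" "f differentiable at x"
  shows "partial_deriv i (\<lambda>x. L (f x)) x = L (partial_deriv i f x)"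
proof -
  have f: "(f has_derivative frechet_derivative f (at x)) (at x)"
    using assms by (simp add: frechet_derivative_works)
  show ?thesis
    using partial_deriv_eqI[OF bounded_linear.has_derivative[OF assms(1) f]]
    by (simp add: partial_deriv_def)
qed

lemma radial_algebra_differentiable: "f \<in> radial_algebra \<Longrightarrow> f differentiable at x"
proof (induction rule: radial_algebra.induct)
  case (coord i)
  then show ?case using has_derivative_coord differentiable_def by blast
next
  case (radial a)
  then obtain a' where a': "\<And>t. (a has_real_derivative a' t) (at t)"
    using smooth_real_has_derivative by blast
  show ?case
    using has_derivative_radial[OF a'] by (rule differentiableI)
qed auto

lemma radial_algebra_partial_deriv:
  "f \<in> radial_algebra \<Longrightarrow> partial_deriv i f \<in> radial_algebra"
proof (induction rule: radial_algebra.induct)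
  case (coord j)
  then show ?case
    by (cases "j = i") (simp_all add: partial_deriv_coord[abs_def] radial_algebra_const)
next
  case (radial a)
  then obtain a' where a': "a' \<in> smooth_real" "\<And>t. (a has_real_derivative a' t) (at t)"
    using smooth_real_has_derivative by blast
  have "partial_deriv i (\<lambda>x. a (x \<bullet> x)) = (\<lambda>x. 2 * a' (x \<bullet> x) * x $ i)"
    using partial_deriv_radial[OF a'(2)] by blast
  then show ?case
    using a' by (simp add: radial_algebra.intros radial_algebra_const)
next
  case (add f h)
  then have "partial_deriv i (\<lambda>x. f x + h x) = (\<lambda>x. partial_deriv i f x + partial_deriv i h x)"
    by (intro ext partial_deriv_add radial_algebra_differentiable)
  then show ?case using add by (simp add: radial_algebra.add)
next
  case (mult f h)
  then have "partial_deriv i (\<lambda>x. f x * h x) = (\<lambda>x. partial_deriv i f x * h x + f x * partial_deriv i h x)"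
    by (intro ext partial_deriv_mult radial_algebra_differentiable)
  then show ?case using mult by (simp add: radial_algebra.add radial_algebra.mult)
qed

lemma radial_algebra_iter_partial:
  "f \<in> radial_algebra \<Longrightarrow> iter_partial is f \<in> radial_algebra"
  by (induction "is") (auto intro: radial_algebra_partial_deriv)

text \<open>Partial derivatives commute with the linear map taking c to c times \<open>v\<close>.
  Vector and matrix valued functions are handled as sums of such terms.\<close>

lemma smooth_on_radial_algebra:
  assumes "f \<in> radial_algebra"
  shows "smooth_on S (\<lambda>x. f x *\<^sub>R v)"
proof -
  have L: "bounded_linear (\<lambda>c::real. c *\<^sub>R v)" by (rule bounded_linear_scaleR_left)
  have "iter_partial is (\<lambda>x. f x *\<^sub>R v) = (\<lambda>x. iter_partial is f x *\<^sub>R v)" for "is"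
    by (induction "is")
       (auto intro!: ext partial_deriv_linear_comp[OF L] radial_algebra_differentiable
          radial_algebra_iter_partial assms)
  then show ?thesis
    using radial_algebra_differentiable[OF radial_algebra_iter_partial[OF assms]]
    by (auto simp: smooth_on_def intro!: differentiable_at_imp_differentiable_on
        differentiable_scaleR)
qed

lemma smooth_on_zero: "smooth_on S (\<lambda>x. 0)"
  by (simp add: smooth_on_def)

lemma smooth_on_add:
  assumes "smooth_on UNIV f" "smooth_on UNIV h"
  shows "smooth_on UNIV (\<lambda>x. f x + h x)"
proof -
  have d: "iter_partial is f differentiable at x" "iter_partial is h differentiable at x" for "is" x
    using assms by (auto simp: smooth_on_def differentiable_on_def)
  have "iter_partial is (\<lambda>x. f x + h x) = (\<lambda>x. iter_partial is f x + iter_partial is h x)" for "is"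
    by (induction "is") (auto intro!: ext partial_deriv_add d)
  then show ?thesis
    using d by (auto simp: smooth_on_def differentiable_on_def intro!: differentiable_add)
qed

lemma smooth_on_sum:
  assumes "finite I" "\<And>i. i \<in> I \<Longrightarrow> smooth_on UNIV (f i)"
  shows "smooth_on UNIV (\<lambda>x. \<Sum>i\<in>I. f i x)"
  using assms by (induction I) (auto simp: smooth_on_zero smooth_on_add)

text \<open>Coordinates times basis vectors add up to the identity, which will serve as the
  asymptotically flat chart.\<close>

lemma smooth_on_id: "smooth_on S (\<lambda>x::real^'n::finite. x)"
proof -
  have "smooth_on UNIV (\<lambda>x::real^'n. \<Sum>i\<in>UNIV. x $ i *\<^sub>R axis i (1::real))"
    by (intro smooth_on_sum smooth_on_radial_algebra radial_algebra.coord) simp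
  moreover have "(\<Sum>i\<in>UNIV. x $ i *\<^sub>R axis i (1::real)) = x" for x :: "real^'n"
    using basis_expansion[of x] by (simp add: scalar_mult_eq_scaleR)
  ultimately have "smooth_on UNIV (\<lambda>x::real^'n. x)" by simp
  then show ?thesis
    unfolding smooth_on_def using differentiable_on_subset by blast
qed

lemma smooth_on_radial_field:
  assumes "a \<in> smooth_real"
  shows "smooth_on UNIV (\<lambda>x::real^'n::finite. a (x \<bullet> x) *\<^sub>R x)"
proof -
  have "smooth_on UNIV (\<lambda>x::real^'n. \<Sum>i\<in>UNIV. (a (x \<bullet> x) * x $ i) *\<^sub>R axis i (1::real))"
    by (intro smooth_on_sum smooth_on_radial_algebra radial_algebra.intros assms) simp
  moreover have "(\<Sum>i\<in>UNIV. (c * x $ i) *\<^sub>R axis i (1::real)) = c *\<^sub>R x" for x :: "real^'n" and c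
    using arg_cong[OF basis_expansion[of x], of "\<lambda>z. c *\<^sub>R z"]
    by (simp add: scalar_mult_eq_scaleR scaleR_sum_right)
  ultimately show ?thesis by simp
qed

subsection \<open>Conformally flat metrics\<close>

lemma sum_scaleR_mat_1:
  fixes F :: "'n::finite \<Rightarrow> real"
  shows "(\<Sum>m\<in>UNIV. (c *\<^sub>R mat 1 :: real^'n^'n) $ l $ m * F m) = c * F l"
proof -
  have "(c *\<^sub>R mat 1 :: real^'n^'n) $ l $ m * F m = (if l = m then c * F m else 0)" for m
    by (simp add: mat_def)
  then show ?thesis by simp
qed

text \<open>The exponential makes positivity automatic and the Christoffel symbols linear in the
  derivatives of \<open>f\<close>; u^(4/(n-2)) corresponds to f = 2/(n-2) ln u.\<close>

definition conformal_metric :: "(real^'n::finite \<Rightarrow> real) \<Rightarrow> real^'n \<Rightarrow> real^'n^'n"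
  where "conformal_metric f x = exp (2 * f x) *\<^sub>R mat 1"

lemma conformal_metric_nth:
  "conformal_metric f x $ i $ j = (if i = j then exp (2 * f x) else 0)"
  by (simp add: conformal_metric_def mat_def)

lemma conformal_metric_mult_vec: "conformal_metric f x *v v = exp (2 * f x) *\<^sub>R v"
  by (simp add: conformal_metric_def scaleR_matrix_vector_assoc[symmetric])

lemma transpose_conformal_metric: "transpose (conformal_metric f x) = conformal_metric f x"
  by (simp add: vec_eq_iff transpose_def conformal_metric_nth)

lemma det_conformal_metric:
  "det (conformal_metric f x :: real^'n::finite^'n) = exp (2 * f x) ^ CARD('n)"
  by (subst det_diagonal) (auto simp: conformal_metric_nth)

lemma matrix_inv_conformal_metric:
  "matrix_inv (conformal_metric f x :: real^'n::finite^'n) = exp (- 2 * f x) *\<^sub>R mat 1"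
proof -
  let ?A = "conformal_metric f x" and ?B = "exp (- 2 * f x) *\<^sub>R mat 1 :: real^'n^'n"
  have AB: "?A ** ?B = mat 1" and BA: "?B ** ?A = mat 1"
    by (simp_all add: conformal_metric_def matrix_scalar_ac scalar_matrix_assoc[symmetric]
        exp_add[symmetric])
  \<comment> \<open>\<open>matrix_inv\<close> is a choice among two-sided inverses, so its value is
    found by existence of one and then uniqueness.\<close>
  then have "?A ** matrix_inv ?A = mat 1"
    unfolding matrix_inv_def by (rule_tac someI2_ex) blast+
  then show ?thesis
    by (metis AB BA matrix_mul_assoc matrix_mul_lid matrix_mul_rid)
qed

lemma metric_norm_conformal_metric: "metric_norm (conformal_metric f) x v = exp (f x) * norm v"
proof -
  have "exp (2 * f x) = exp (f x) ^ 2"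
    by (simp add: exp_double)
  then show ?thesis
    by (simp add: metric_norm_def conformal_metric_mult_vec real_sqrt_mult norm_eq_sqrt_inner)
qed

lemma has_derivative_exp_cmult:
  fixes f :: "real^'n::finite \<Rightarrow> real"
  assumes "f differentiable at x"
  shows "((\<lambda>x. exp (c * f x)) has_derivative
      (\<lambda>v. exp (c * f x) * (c * frechet_derivative f (at x) v))) (at x)"
proof -
  have f: "(f has_derivative frechet_derivative f (at x)) (at x)"
    using assms by (simp add: frechet_derivative_works)
  show ?thesis
    by (rule derivative_eq_intros f refl)+ (simp add: mult_ac)
qed

lemma partial_deriv_exp_cmult:
  fixes f :: "real^'n::finite \<Rightarrow> real"
  assumes "f differentiable at x"
  shows "partial_deriv i (\<lambda>x. exp (c * f x)) x = c * exp (c * f x) * partial_deriv i f x"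
  using partial_deriv_eqI[OF has_derivative_exp_cmult[OF assms]]
  by (simp add: partial_deriv_def)

lemma partial_deriv_conformal_metric:
  assumes "f differentiable at x"
  shows "partial_deriv k (\<lambda>y. conformal_metric f y $ i $ j) x
    = (if i = j then 2 * exp (2 * f x) * partial_deriv k f x else 0)"
  using partial_deriv_exp_cmult[OF assms, of k 2]
  by (cases "i = j") (simp_all add: conformal_metric_nth)

text \<open>The exponentials of the metric and of its inverse cancel. What remains is linear in the
  first derivatives of \<open>f\<close> with constant coefficients and can be differentiated again
  term by term.\<close>

lemma christoffel_conformal_metric:
  assumes f: "\<And>x. f differentiable at x"
  shows "christoffel (conformal_metric f) l i j = (\<lambda>x.
    (if l = j then partial_deriv i f x else 0) + (if l = i then partial_deriv j f x else 0)
    - (if i = j then partial_deriv l f x else 0))"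
proof
  fix x
  have "christoffel (conformal_metric f) l i j x = (1/2) * (exp (- 2 * f x) *
      (partial_deriv i (\<lambda>y. conformal_metric f y $ j $ l) x
        + partial_deriv j (\<lambda>y. conformal_metric f y $ i $ l) x
        - partial_deriv l (\<lambda>y. conformal_metric f y $ i $ j) x))"
    unfolding christoffel_def matrix_inv_conformal_metric sum_scaleR_mat_1 ..
  also have "\<dots> = (exp (- 2 * f x) * exp (2 * f x)) *
    ((if l = j then partial_deriv i f x else 0) + (if l = i then partial_deriv j f x else 0)
    - (if i = j then partial_deriv l f x else 0))"
    unfolding partial_deriv_conformal_metric[OF f] by (simp add: algebra_simps)
  also have "exp (- 2 * f x) * exp (2 * f x) = 1"
    by (simp add: exp_add[symmetric])
  finally show "christoffel (conformal_metric f) l i j x =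
    (if l = j then partial_deriv i f x else 0) + (if l = i then partial_deriv j f x else 0)
    - (if i = j then partial_deriv l f x else 0)" by simp
qed

lemma partial_deriv_diff:
  fixes f h :: "real^'n::finite \<Rightarrow> real"
  assumes "f differentiable at x" "h differentiable at x"
  shows "partial_deriv i (\<lambda>x. f x - h x) x = partial_deriv i f x - partial_deriv i h x"
  using partial_deriv_add[OF assms(1), of "\<lambda>x. (-1) * h x"]
    partial_deriv_linear_comp[OF bounded_linear_mult_right assms(2), of i "-1"] assms
  by simp

text \<open>Kronecker deltas appear as conditionals that do not depend on the point, so they behave
  as constants.\<close>

lemma partial_deriv_if_zero:
  "partial_deriv i (\<lambda>x. if P then f x else 0) x = (if P then partial_deriv i f x else (0::real))"
  by (cases P) simp_all

lemma differentiable_if_zero: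
  "f differentiable at x \<Longrightarrow> (\<lambda>x. if P then f x else (0::real)) differentiable at x"
  by (cases P) simp_all

text \<open>The classical conformal change formula over a flat background. As the inverse metric is
  diagonal, only diagonal Ricci entries are traced. The derivative terms give (2-n) \<Delta> - n
  \<Delta>, the quadratic ones n (2-n) E - (2-n) E.\<close>

theorem scalar_curvature_conformal_metric:
  fixes f :: "real^'n::finite \<Rightarrow> real"
  assumes f: "\<And>x. f differentiable at x"
    and df: "\<And>i x. partial_deriv i f differentiable at x"
  shows "scalar_curvature (conformal_metric f) x = - exp (- 2 * f x) *
    (2 * (real CARD('n) - 1) * (\<Sum>i\<in>UNIV. partial_deriv i (partial_deriv i f) x)
     + (real CARD('n) - 1) * (real CARD('n) - 2) * (\<Sum>i\<in>UNIV. (partial_deriv i f x)\<^sup>2))"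
proof -
  define \<Delta> where "\<Delta> = (\<Sum>i\<in>UNIV. partial_deriv i (partial_deriv i f) x)"
  define E where "E = (\<Sum>i\<in>UNIV. (partial_deriv i f x)\<^sup>2)"
  define p where "p i = partial_deriv i f x" for i
  define h where "h i j = partial_deriv i (partial_deriv j f) x" for i j
  define \<Gamma> where "\<Gamma> l i j = christoffel (conformal_metric f) l i j x" for l i j
  define n where "n = real CARD('n)"
  have \<Gamma>: "\<Gamma> l i j = (if l = j then p i else 0) + (if l = i then p j else 0) - (if i = j then p l else 0)" for l i j
    by (simp add: \<Gamma>_def p_def christoffel_conformal_metric[OF f])
  have d\<Gamma>: "partial_deriv k (christoffel (conformal_metric f) l i j) x
     = (if l = j then h k i else 0) + (if l = i then h k j else 0) - (if i = j then h k l else 0)" for k l i j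
    unfolding christoffel_conformal_metric[OF f]
    by (simp add: partial_deriv_diff partial_deriv_add partial_deriv_if_zero differentiable_if_zero
        differentiable_add df h_def)
  have "scalar_curvature (conformal_metric f) x
      = exp (- 2 * f x) * (\<Sum>j\<in>UNIV. ricci (conformal_metric f) j j x)"
    unfolding scalar_curvature_def matrix_inv_conformal_metric sum_scaleR_mat_1
    by (simp add: sum_distrib_left)
  also have "(\<Sum>j\<in>UNIV. ricci (conformal_metric f) j j x) =
     (\<Sum>j\<in>UNIV. \<Sum>i\<in>UNIV. partial_deriv i (christoffel (conformal_metric f) i j j) x)
     - (\<Sum>j\<in>UNIV. \<Sum>i\<in>UNIV. partial_deriv j (christoffel (conformal_metric f) i i j) x)
     + (\<Sum>j\<in>UNIV. \<Sum>i\<in>UNIV. \<Sum>m\<in>UNIV. \<Gamma> i i m * \<Gamma> m j j)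
     - (\<Sum>j\<in>UNIV. \<Sum>i\<in>UNIV. \<Sum>m\<in>UNIV. \<Gamma> i j m * \<Gamma> m i j)"
    unfolding ricci_def riemann_def \<Gamma>_def by (simp add: sum.distrib sum_subtractf)
  also have "(\<Sum>j\<in>UNIV. \<Sum>i\<in>UNIV. partial_deriv i (christoffel (conformal_metric f) i j j) x) = (2 - n) * \<Delta>"
    unfolding d\<Gamma>
    by (simp add: sum.distrib sum_subtractf sum_distrib_left[symmetric] \<Delta>_def h_def n_def algebra_simps)
  also have "(\<Sum>j\<in>UNIV. \<Sum>i\<in>UNIV. partial_deriv j (christoffel (conformal_metric f) i i j) x) = n * \<Delta>"
    unfolding d\<Gamma>
    by (simp add: sum.distrib sum_subtractf sum_distrib_left[symmetric] \<Delta>_def h_def n_def)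
  also have "(\<Sum>j\<in>UNIV. \<Sum>i\<in>UNIV. \<Sum>m\<in>UNIV. \<Gamma> i i m * \<Gamma> m j j) = n * (2 - n) * E"
  proof -
    \<comment> \<open>The two traces of the symbols factor the triple sum once the summation order
      is changed.\<close>
    have 1: "(\<Sum>i\<in>UNIV. \<Gamma> i i m) = n * p m" for m
      unfolding \<Gamma> by (simp add: sum.distrib sum_subtractf n_def)
    have 2: "(\<Sum>j\<in>UNIV. \<Gamma> m j j) = (2 - n) * p m" for m
      unfolding \<Gamma> by (simp add: sum.distrib sum_subtractf n_def sum_distrib_left[symmetric] algebra_simps)
    have "(\<Sum>j\<in>UNIV. \<Sum>i\<in>UNIV. \<Sum>m\<in>UNIV. \<Gamma> i i m * \<Gamma> m j j)
       = (\<Sum>j\<in>UNIV. \<Sum>m\<in>UNIV. \<Sum>i\<in>UNIV. \<Gamma> i i m * \<Gamma> m j j)"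
      by (rule sum.cong[OF refl sum.swap])
    also have "\<dots> = (\<Sum>m\<in>UNIV. \<Sum>j\<in>UNIV. n * p m * \<Gamma> m j j)"
      by (subst sum.swap) (simp add: sum_distrib_right[symmetric] 1)
    also have "\<dots> = (\<Sum>m\<in>UNIV. n * (2 - n) * (p m)\<^sup>2)"
      by (simp add: sum_distrib_left[symmetric] 2 power2_eq_square mult_ac)
    finally show ?thesis
      by (simp add: E_def p_def sum_distrib_left)
  qed
  also have "(\<Sum>j\<in>UNIV. \<Sum>i\<in>UNIV. \<Sum>m\<in>UNIV. \<Gamma> i j m * \<Gamma> m i j) = (2 - n) * E"
  proof -
    \<comment> \<open>Of the nine products of deltas, three contain a single condition on the
      indices. The other six need all three indices equal and add up to twice the square.\<close>
    have *: "\<Gamma> i j m * \<Gamma> m i j = (if i = m then (p j)\<^sup>2 else 0) - (if i = j then (p m)\<^sup>2 else 0)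
        - (if j = m then (p i)\<^sup>2 else 0) + (if i = j then if j = m then 2 * (p m)\<^sup>2 else 0 else 0)" for i j m
      unfolding \<Gamma> by (auto simp: power2_eq_square algebra_simps)
    have **: "(\<Sum>k\<in>UNIV. if Q then F k else 0) = (if Q then \<Sum>k\<in>UNIV. F k else 0)"
      for Q and F :: "'n \<Rightarrow> real"
      by simp
    show ?thesis
      unfolding * by (simp add: ** sum.distrib sum_subtractf E_def p_def n_def sum_distrib_left[symmetric] left_diff_distrib)
  qed
  finally show ?thesis
    by (simp add: \<Delta>_def E_def n_def algebra_simps)
qed

text \<open>For each single i the symbol \<Gamma>^i_ij is the j-th derivative of \<open>f\<close>;
  summing over i produces the dimension.\<close>

lemma divergence_conformal_metric:
  fixes f :: "real^'n::finite \<Rightarrow> real"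
  assumes f: "\<And>x. f differentiable at x"
  shows "divergence (conformal_metric f) X x = (\<Sum>i\<in>UNIV. partial_deriv i (\<lambda>y. X y $ i) x)
    + real CARD('n) * (\<Sum>i\<in>UNIV. partial_deriv i f x * X x $ i)"
proof -
  have "(\<Sum>i\<in>UNIV. \<Sum>j\<in>UNIV. christoffel (conformal_metric f) i i j x * X x $ j)
      = (\<Sum>i::'n\<in>UNIV. \<Sum>j\<in>UNIV. partial_deriv j f x * X x $ j)"
    by (intro sum.cong refl) (auto simp: christoffel_conformal_metric[OF f])
  then show ?thesis
    by (simp add: divergence_def sum.distrib)
qed

text \<open>The conformal factor enters so that \<open>X\<close> is the gradient of \<open>p\<close> for the conformal metric.\<close>

lemma divergence_conformal_gradient:
  fixes f p :: "real^'n::finite \<Rightarrow> real"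
  assumes f: "\<And>x. f differentiable at x"
    and dp: "\<And>i x. partial_deriv i p differentiable at x"
    and X: "\<And>x i. X x $ i = exp (- 2 * f x) * partial_deriv i p x"
  shows "divergence (conformal_metric f) X x = exp (- 2 * f x) *
    ((\<Sum>i\<in>UNIV. partial_deriv i (partial_deriv i p) x)
     + (real CARD('n) - 2) * (\<Sum>i\<in>UNIV. partial_deriv i f x * partial_deriv i p x))"
proof -
  have e: "(\<lambda>x. exp (- 2 * f x)) differentiable at x" for x
    using has_derivative_exp_cmult[OF f] by (rule differentiableI)
  \<comment> \<open>Differentiating the inverse metric factor costs 2, which turns the dimension
    from the volume term into n - 2.\<close>
  have *: "partial_deriv i (\<lambda>y. X y $ i) x = exp (- 2 * f x) *
      (partial_deriv i (partial_deriv i p) x - 2 * (partial_deriv i f x * partial_deriv i p x))" for i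
    unfolding X partial_deriv_mult[OF e dp] partial_deriv_exp_cmult[OF f]
    by (simp add: algebra_simps)
  have "(\<Sum>i\<in>UNIV. partial_deriv i f x * X x $ i)
      = exp (- 2 * f x) * (\<Sum>i\<in>UNIV. partial_deriv i f x * partial_deriv i p x)"
    by (simp add: X sum_distrib_left mult_ac)
  moreover have "(\<Sum>i\<in>UNIV. partial_deriv i (\<lambda>y. X y $ i) x) = exp (- 2 * f x) *
      ((\<Sum>i\<in>UNIV. partial_deriv i (partial_deriv i p) x)
       - 2 * (\<Sum>i\<in>UNIV. partial_deriv i f x * partial_deriv i p x))"
    unfolding * by (simp only: sum_distrib_left[symmetric] sum_subtractf)
  ultimately show ?thesis
    unfolding divergence_conformal_metric[OF f]
    by (simp only:) (simp add: algebra_simps)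
qed

lemma continuous_on_radial:
  assumes "continuous_on UNIV a"
  shows "continuous_on S (\<lambda>x::'a::real_inner. a (x \<bullet> x) :: real)"
  by (intro continuous_on_compose2[OF assms]) (auto intro!: continuous_intros)

text \<open>Against Lebesgue measure the integrand becomes \<open>h\<close> times a continuous
  density, hence a continuous function vanishing off a compact ball.\<close>

lemma integrable_volume_measure_conformal:
  fixes f :: "real^'n::finite \<Rightarrow> real" and h :: "real^'n \<Rightarrow> real"
  assumes f: "continuous_on UNIV f" and h: "continuous_on UNIV h"
    and zero: "\<And>x. norm x > r \<Longrightarrow> h x = 0"
  shows "integrable (volume_measure (conformal_metric f)) h"
proof -
  have c: "continuous_on UNIV (\<lambda>x. sqrt (exp (2 * f x) ^ CARD('n)))"
    by (intro continuous_intros f)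
  have "integrable lborel (\<lambda>x. indicator (cball 0 r) x *\<^sub>R (sqrt (exp (2 * f x) ^ CARD('n)) *\<^sub>R h x))"
    using f h by (intro borel_integrable_compact continuous_intros) (auto intro: continuous_on_subset)
  moreover have "(\<lambda>x. indicator (cball 0 r) x *\<^sub>R (sqrt (exp (2 * f x) ^ CARD('n)) *\<^sub>R h x))
      = (\<lambda>x. sqrt (exp (2 * f x) ^ CARD('n)) *\<^sub>R h x)"
    using zero by (force simp: indicator_def)
  ultimately have "integrable lborel (\<lambda>x. sqrt (exp (2 * f x) ^ CARD('n)) *\<^sub>R h x)" by simp
  then show ?thesis
    unfolding volume_measure_def det_conformal_metric
    using c h by (subst integrable_density) (auto intro: borel_measurable_continuous_onI)
qed

subsection \<open>Radial conformal factors\<close>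

lemma smooth_on_conformal_metric:
  assumes "F \<in> smooth_real"
  shows "smooth_on UNIV (conformal_metric (\<lambda>x. F (x \<bullet> x)))"
proof -
  have "(\<lambda>x. exp (2 * F (x \<bullet> x))) \<in> radial_algebra"
    using assms by (intro radial_algebra.radial[of "\<lambda>t. exp (2 * F t)"] smooth_real.exp smooth_real_cmult)
  from smooth_on_radial_algebra[OF this, where v = "mat 1"] show ?thesis
    by (simp add: conformal_metric_def[abs_def])
qed

lemma partial_deriv_partial_deriv_radial:
  assumes a: "\<And>t. (a has_real_derivative a' t) (at t)"
    and a': "\<And>t. (a' has_real_derivative a'' t) (at t)"
  shows "partial_deriv j (partial_deriv i (\<lambda>x::real^'n::finite. a (x \<bullet> x))) x
    = 4 * a'' (x \<bullet> x) * x $ i * x $ j + (if i = j then 2 * a' (x \<bullet> x) else 0)"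
proof -
  have eq: "partial_deriv i (\<lambda>x. a (x \<bullet> x)) = (\<lambda>x. (2 * a' (x \<bullet> x)) * x $ i)"
    using partial_deriv_radial[OF a] by blast
  have 2: "((\<lambda>t. 2 * a' t) has_real_derivative 2 * a'' t) (at t)" for t
    by (intro DERIV_cmult a')
  have d: "(\<lambda>x::real^'n. 2 * a' (x \<bullet> x)) differentiable at x"
    "(\<lambda>x::real^'n. x $ i) differentiable at x"
    using has_derivative_radial[OF 2] has_derivative_coord by (blast intro: differentiableI)+
  show ?thesis
    unfolding eq partial_deriv_mult[OF d] partial_deriv_coord partial_deriv_radial[OF 2]
    by simp
qed

lemma sum_square_coord: "(\<Sum>i\<in>UNIV. (x $ i)\<^sup>2) = x \<bullet> x" for x :: "real^'n"
  by (simp add: inner_vec_def power2_eq_square)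

lemma sum_partial_deriv_partial_deriv_radial:
  assumes a: "\<And>t. (a has_real_derivative a' t) (at t)"
    and a': "\<And>t. (a' has_real_derivative a'' t) (at t)"
  shows "(\<Sum>i\<in>UNIV. partial_deriv i (partial_deriv i (\<lambda>x::real^'n::finite. a (x \<bullet> x))) x)
    = 4 * (x \<bullet> x) * a'' (x \<bullet> x) + 2 * real CARD('n) * a' (x \<bullet> x)"
proof -
  have "(\<Sum>i\<in>UNIV. 4 * a'' (x \<bullet> x) * (x $ i)\<^sup>2) = 4 * a'' (x \<bullet> x) * (x \<bullet> x)"
    by (simp only: sum_distrib_left[symmetric] sum_square_coord)
  then show ?thesis
    unfolding partial_deriv_partial_deriv_radial[OF assms]
    by (simp add: sum.distrib power2_eq_square mult_ac)
qed

lemma sum_partial_deriv_mult_radial: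
  assumes a: "\<And>t. (a has_real_derivative a' t) (at t)"
    and b: "\<And>t. (b has_real_derivative b' t) (at t)"
  shows "(\<Sum>i\<in>UNIV. partial_deriv i (\<lambda>x::real^'n::finite. a (x \<bullet> x)) x
      * partial_deriv i (\<lambda>x. b (x \<bullet> x)) x)
    = 4 * (x \<bullet> x) * a' (x \<bullet> x) * b' (x \<bullet> x)"
proof -
  have "(\<Sum>i\<in>UNIV. 4 * a' (x \<bullet> x) * b' (x \<bullet> x) * (x $ i)\<^sup>2)
      = 4 * a' (x \<bullet> x) * b' (x \<bullet> x) * (x \<bullet> x)"
    by (simp only: sum_distrib_left[symmetric] sum_square_coord)
  then show ?thesis
    unfolding partial_deriv_radial[OF a] partial_deriv_radial[OF b]
    by (simp add: power2_eq_square mult_ac)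
qed

text \<open>Write \<open>v = 2/(n-2) ln u\<close>. The metric is \<open>exp (-2w) u^(4/(n-2))\<close> times the Euclidean one and
  \<open>X\<close> is its gradient of \<open>-(n-1) w\<close>; then \<open>R + 2 div X\<close> sees only the curvature of
  \<open>u^(4/(n-2))\<close> and the square of the gradient of \<open>w\<close>.\<close>

lemma
  fixes v w :: "real \<Rightarrow> real" and X :: "real^'n::finite \<Rightarrow> real^'n"
  assumes v: "\<And>t. (v has_real_derivative v' t) (at t)" "\<And>t. (v' has_real_derivative v'' t) (at t)"
    and w: "\<And>t. (w has_real_derivative w' t) (at t)" "\<And>t. (w' has_real_derivative w'' t) (at t)"
  defines "n \<equiv> real CARD('n)"
  defines "g \<equiv> conformal_metric (\<lambda>x. v (x \<bullet> x) - w (x \<bullet> x))"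
  defines "X \<equiv> \<lambda>x. (- 2 * (n - 1) * exp (- 2 * (v (x \<bullet> x) - w (x \<bullet> x))) * w' (x \<bullet> x)) *\<^sub>R x"
  assumes t: "t = x \<bullet> x"
  shows scalar_curvature_plus_divergence_radial:
    "scalar_curvature g x + 2 * divergence g X x = exp (- 2 * (v t - w t)) *
      (4 * (n - 1) * (n - 2) * t * (w' t)\<^sup>2
       - (2 * (n - 1) * (4 * t * v'' t + 2 * n * v' t) + 4 * (n - 1) * (n - 2) * t * (v' t)\<^sup>2))"
    and metric_norm_radial_gradient:
    "(metric_norm g x (X x))\<^sup>2 = exp (- 2 * (v t - w t)) * (4 * (n - 1)\<^sup>2 * t * (w' t)\<^sup>2)"
proof -
  define f where "f t = v t - w t" for t
  \<comment> \<open>With this multiple the second derivatives of \<open>w\<close> cancel between the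
    curvature and twice the divergence, and so do its linear first-order terms and the mixed terms
    in \<open>v'\<close> and \<open>w'\<close>.\<close>
  define p where "p t = - (n - 1) * w t" for t
  have f: "(f has_real_derivative v' t - w' t) (at t)"
    and f': "((\<lambda>t. v' t - w' t) has_real_derivative v'' t - w'' t) (at t)" for t
    unfolding f_def by (intro DERIV_diff v w)+
  have p: "(p has_real_derivative - (n - 1) * w' t) (at t)"
    and p': "((\<lambda>t. - (n - 1) * w' t) has_real_derivative - (n - 1) * w'' t) (at t)" for t
    unfolding p_def by (intro DERIV_cmult w)+
  have differentiable: "(\<lambda>x::real^'n. a (x \<bullet> x)) differentiable at x"
      "partial_deriv i (\<lambda>x::real^'n. a (x \<bullet> x)) differentiable at x"
    if a: "\<And>t. (a has_real_derivative a' t) (at t)" "\<And>t. (a' has_real_derivative a'' t) (at t)"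
    for a a' a'' i x
  proof -
    show "(\<lambda>x::real^'n. a (x \<bullet> x)) differentiable at x"
      using has_derivative_radial[OF a(1)] by (rule differentiableI)
    have "(\<lambda>x::real^'n. a' (x \<bullet> x)) differentiable at x"
      using has_derivative_radial[OF a(2)] by (rule differentiableI)
    moreover have "(\<lambda>x::real^'n. x $ i) differentiable at x"
      using has_derivative_coord by (rule differentiableI)
    moreover have "partial_deriv i (\<lambda>x::real^'n. a (x \<bullet> x)) = (\<lambda>x. 2 * a' (x \<bullet> x) * x $ i)"
      using partial_deriv_radial[OF a(1)] by blast
    ultimately show "partial_deriv i (\<lambda>x::real^'n. a (x \<bullet> x)) differentiable at x"
      by (simp add: differentiable_mult)
  qed
  have g: "g = conformal_metric (\<lambda>x. f (x \<bullet> x))"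
    by (simp add: g_def f_def)
  have X: "X x $ i = exp (- 2 * f (x \<bullet> x)) * partial_deriv i (\<lambda>x. p (x \<bullet> x)) x" for x i
    unfolding partial_deriv_radial[OF p] by (simp add: X_def f_def)
  have R: "scalar_curvature g x = - exp (- 2 * f t) *
     (2 * (n - 1) * (4 * t * (v'' t - w'' t) + 2 * n * (v' t - w' t))
      + (n - 1) * (n - 2) * (4 * t * (v' t - w' t) * (v' t - w' t)))"
    unfolding g scalar_curvature_conformal_metric[OF differentiable[OF f f']] power2_eq_square
      sum_partial_deriv_partial_deriv_radial[OF f f'] sum_partial_deriv_mult_radial[OF f f]
    by (simp add: t n_def)
  have D: "divergence g X x = exp (- 2 * f t) *
     (4 * t * (- (n - 1) * w'' t) + 2 * n * (- (n - 1) * w' t)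
      + (n - 2) * (4 * t * (v' t - w' t) * (- (n - 1) * w' t)))"
    unfolding g divergence_conformal_gradient[OF differentiable(1)[OF f f'] differentiable(2)[OF p p'] X]
      sum_partial_deriv_partial_deriv_radial[OF p p'] sum_partial_deriv_mult_radial[OF f p]
    by (simp add: t n_def)
  show "scalar_curvature g x + 2 * divergence g X x = exp (- 2 * (v t - w t)) *
      (4 * (n - 1) * (n - 2) * t * (w' t)\<^sup>2
       - (2 * (n - 1) * (4 * t * v'' t + 2 * n * v' t) + 4 * (n - 1) * (n - 2) * t * (v' t)\<^sup>2))"
    unfolding R D f_def[symmetric] by (simp add: power2_eq_square algebra_simps)
  have "metric_norm g x (X x) = exp (f t) * norm (X x)"
    by (simp add: g metric_norm_conformal_metric t)
  also have "(\<dots>)\<^sup>2 = (exp (f t))\<^sup>2 * (X x \<bullet> X x)"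
    by (simp add: power_mult_distrib dot_square_norm)
  also have "X x \<bullet> X x = 4 * (n - 1)\<^sup>2 * (exp (- 2 * f t))\<^sup>2 * (w' t)\<^sup>2 * t"
    by (simp add: X_def f_def t power2_eq_square algebra_simps)
  also have "(exp (f t))\<^sup>2 = exp (2 * f t)"
    by (simp add: exp_double)
  also have "exp (2 * f t) * (4 * (n - 1)\<^sup>2 * (exp (- 2 * f t))\<^sup>2 * (w' t)\<^sup>2 * t)
     = (exp (2 * f t) * exp (- 2 * f t)) * exp (- 2 * f t) * (4 * (n - 1)\<^sup>2 * t * (w' t)\<^sup>2)"
    by (simp add: power2_eq_square)
  also have "exp (2 * f t) * exp (- 2 * f t) = 1"
    by (simp add: exp_add[symmetric])
  finally show "(metric_norm g x (X x))\<^sup>2 = exp (- 2 * (v t - w t)) * (4 * (n - 1)\<^sup>2 * t * (w' t)\<^sup>2)"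
    by (simp add: f_def)
qed

subsection \<open>Asymptotics in the identity chart\<close>

lemma chart_metric_ident: "chart_metric (\<lambda>x. x) g = g"
  by (simp add: chart_metric_def fun_eq_iff frechet_derivative_ident matrix_id_mat_1[unfolded id_def]
      transpose_mat)

lemma chart_field_ident: "chart_field (\<lambda>x. x) (\<lambda>x. x) X = X"
  by (simp add: chart_field_def fun_eq_iff frechet_derivative_ident)

text \<open>The metric is global, so any closed ball may be taken out; the radius 1 is
  arbitrary.\<close>

lemma af_chart_ident:
  fixes g :: "real^'n::finite \<Rightarrow> real^'n^'n"
  assumes "\<tau> > (real CARD('n) - 2) / 2"
    and "\<And>i j. bigO2 \<tau> (\<lambda>y. g y $ i $ j - (if i = j then 1 else 0))"
  shows "af_chart g (\<lambda>x. x) (\<lambda>x. x)"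
proof -
  have "homeomorphism (- cball 0 1) (- cball 0 1) (\<lambda>x. x) (\<lambda>x::real^'n. x)"
    by (simp add: homeomorphism_ident)
  then show ?thesis
    unfolding af_chart_def chart_metric_ident
    using assms by (intro conjI exI[of _ "cball 0 1"] exI[of _ 1] exI[of _ \<tau>])
      (auto intro: smooth_on_id)
qed

text \<open>With t = r^2, each derivative in t gains a factor r^(-2), whereas the chain rule costs
  one coordinate, at most r; the net gain is 1/r per partial derivative.\<close>

lemma bigO2_radial:
  assumes a: "\<And>t. (a has_real_derivative a' t) (at t)"
    and a': "\<And>t. (a' has_real_derivative a'' t) (at t)"
    and C: "\<And>t. t \<ge> T \<Longrightarrow> \<bar>a t\<bar> \<le> C * t powr (- \<tau> / 2)"
      "\<And>t. t \<ge> T \<Longrightarrow> \<bar>a' t\<bar> \<le> C * t powr (- \<tau> / 2 - 1)"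
      "\<And>t. t \<ge> T \<Longrightarrow> \<bar>a'' t\<bar> \<le> C * t powr (- \<tau> / 2 - 2)"
    and "C > 0"
  shows "bigO2 \<tau> (\<lambda>x::real^'n::finite. a (x \<bullet> x))"
  unfolding bigO2_def
proof (intro exI conjI)
  \<comment> \<open>6 = 4 + 2 comes from the second derivatives, 4 a'' times two coordinates plus 2
    a' on the diagonal.\<close>
  show "6 * C > 0" using \<open>C > 0\<close> by simp
  have "\<forall>\<^sub>F x::real^'n in at_infinity. norm x \<ge> max 1 T"
    unfolding eventually_at_infinity by blast
  then show "\<forall>\<^sub>F x in at_infinity. \<forall>is. length is \<le> 2 \<longrightarrow>
     \<bar>iter_partial is (\<lambda>x::real^'n. a (x \<bullet> x)) x\<bar> \<le> 6 * C * norm x powr (- real (length is) - \<tau>)"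
  proof (eventually_elim, intro allI impI)
    fix x :: "real^'n" and "is" :: "'n list"
    assume x: "norm x \<ge> max 1 T" and l: "length is \<le> 2"
    define r where "r = norm x"
    define t where "t = x \<bullet> x"
    have r: "r \<ge> 1" "r \<ge> T" and t: "t = r * r"
      using x by (auto simp: r_def t_def dot_square_norm power2_eq_square)
    \<comment> \<open>The bounds are hypotheses on t, so r \<ge> 1 is used to pass from r \<ge> T to
      r^2 \<ge> T.\<close>
    have "r * 1 \<le> r * r"
      using r by (intro mult_left_mono) auto
    then have "t \<ge> T" using r t by linarith
    have tr: "t powr p = r powr (2 * p)" for p
      using r by (simp add: t powr_mult powr_add[symmetric])
    have xi: "\<bar>x $ i\<bar> \<le> r" for i
      unfolding r_def by (rule component_le_norm_cart)
    have b0: "\<bar>a t\<bar> \<le> C * r powr (- \<tau>)" and b1: "\<bar>a' t\<bar> \<le> C * r powr (- \<tau> - 2)"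
      and b2: "\<bar>a'' t\<bar> \<le> C * r powr (- \<tau> - 4)"
      using C[OF \<open>t \<ge> T\<close>] by (simp_all add: tr algebra_simps)
    consider "is = []" | i where "is = [i]" | i j where "is = [j, i]"
      using l by (cases "is"; cases "tl is"; cases "tl (tl is)") auto
    then show "\<bar>iter_partial is (\<lambda>x::real^'n. a (x \<bullet> x)) x\<bar>
        \<le> 6 * C * norm x powr (- real (length is) - \<tau>)"
    proof cases
      case 1
      have "C * r powr (- \<tau>) \<le> 6 * (C * r powr (- \<tau>))"
        using \<open>C > 0\<close> by simp
      with 1 b0 show ?thesis by (simp add: r_def t_def)
    next
      case 2
      have "\<bar>2 * a' t * x $ i\<bar> = 2 * (\<bar>a' t\<bar> * \<bar>x $ i\<bar>)" by (simp add: abs_mult)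
      also have "\<dots> \<le> 2 * (C * r powr (- \<tau> - 2) * r)"
        using b1 xi[of i] r \<open>C > 0\<close> by (intro mult_left_mono mult_mono) auto
      also have "\<dots> = 2 * C * r powr (- 1 - \<tau>)"
        using r powr_add[of r "- \<tau> - 2" 1] by simp
      also have "\<dots> \<le> 6 * C * r powr (- 1 - \<tau>)"
        using \<open>C > 0\<close> by simp
      finally show ?thesis
        using 2 by (simp add: partial_deriv_radial[OF a] r_def t_def)
    next
      case 3
      have "\<bar>4 * a'' t * x $ i * x $ j + (if i = j then 2 * a' t else 0)\<bar>
          \<le> 4 * (\<bar>a'' t\<bar> * (\<bar>x $ i\<bar> * \<bar>x $ j\<bar>)) + 2 * \<bar>a' t\<bar>"
        by (rule order_trans[OF abs_triangle_ineq]) (simp add: abs_mult)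
      also have "\<dots> \<le> 4 * (C * r powr (- \<tau> - 4) * (r * r)) + 2 * (C * r powr (- \<tau> - 2))"
        using b1 b2 xi[of i] xi[of j] r \<open>C > 0\<close> by (intro add_mono mult_left_mono mult_mono) auto
      also have "r powr (- \<tau> - 4) * (r * r) = r powr (- 2 - \<tau>)"
        using r powr_add[of r "- \<tau> - 4" 2] by (simp add: power2_eq_square)
      then have "4 * (C * r powr (- \<tau> - 4) * (r * r)) + 2 * (C * r powr (- \<tau> - 2))
          = 6 * C * r powr (- 2 - \<tau>)"
        by (simp add: mult.assoc minus_diff_commute[of \<tau> 2])
      finally show ?thesis
        using 3 by (cases "i = j") (simp_all add: partial_deriv_partial_deriv_radial[OF a a'] r_def t_def)
    qed
  qed
qed

subsection \<open>The mass of a radial conformal factor\<close>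

lemma measurable_radial_projection:
  "(\<lambda>x::real^'n::finite. (r / norm x) *\<^sub>R x) \<in> measurable (restrict_space lborel (cball 0 1 - {0})) borel"
  by (intro measurable_restrict_space1) simp

lemma emeasure_sphere_measure:
  assumes "A \<in> sets borel"
  shows "emeasure (sphere_measure r) A = ennreal (real CARD('n) * r ^ (CARD('n) - 1)) *
    emeasure lborel ({x. (r / norm x) *\<^sub>R x \<in> A} \<inter> (cball 0 1 - {0} :: (real^'n::finite) set))"
  unfolding sphere_measure_def emeasure_scale_measure
    emeasure_distr[OF measurable_radial_projection assms]
  by (subst emeasure_restrict_space)
     (auto simp: space_restrict_space intro!: arg_cong2[where f = "(*)"] arg_cong[where f = "emeasure lborel"])

text \<open>Radial projection sends the punctured unit ball into the sphere, so a Borel set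
  containing the sphere receives the whole mass. Both the sphere and the whole space are used as
  \<open>A\<close>.\<close>

lemma sphere_measure_eq:
  fixes A :: "(real^'n::finite) set"
  assumes "A \<in> sets borel" "sphere 0 r \<subseteq> A" "r > 0"
  shows "measure (sphere_measure r) A = real CARD('n) * r ^ (CARD('n) - 1) *
    measure lborel (cball 0 1 :: (real^'n::finite) set)"
    and "emeasure (sphere_measure r) A < \<infinity>"
proof -
  have "norm ((r / norm x) *\<^sub>R x) = r" if "x \<noteq> 0" for x :: "real^'n"
    using that \<open>r > 0\<close> by simp
  then have "{x. (r / norm x) *\<^sub>R x \<in> A} \<inter> (cball 0 1 - {0}) = (cball 0 1 - {0} :: (real^'n) set)"
    using assms by force
  moreover have "emeasure lborel (cball 0 1 - {0} :: (real^'n) set) = emeasure lborel (cball 0 1 :: (real^'n) set)"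
    by (intro emeasure_Diff_null_set) (auto simp: null_sets_def)
  ultimately have *: "emeasure (sphere_measure r) A = ennreal (real CARD('n) * r ^ (CARD('n) - 1)) *
     emeasure lborel (cball 0 1 :: (real^'n) set)"
    using emeasure_sphere_measure[OF assms(1), of r] by simp
  show "measure (sphere_measure r) A = real CARD('n) * r ^ (CARD('n) - 1) *
    measure lborel (cball 0 1 :: (real^'n::finite) set)"
    unfolding measure_def * using \<open>r > 0\<close> by (simp add: enn2real_mult)
  show "emeasure (sphere_measure r) A < \<infinity>"
    unfolding * using emeasure_lborel_cball_finite[of "0::real^'n" 1]
    by (simp add: ennreal_mult_less_top)
qed

lemma AE_sphere_measure:
  assumes "r > 0"
  shows "AE x in (sphere_measure r :: (real^'n::finite) measure). norm x = r"
proof (rule AE_I')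
  let ?N = "- sphere 0 r :: (real^'n) set"
  have "norm ((r / norm x) *\<^sub>R x) = r" if "x \<noteq> 0" for x :: "real^'n"
    using that \<open>r > 0\<close> by simp
  then have "{x. (r / norm x) *\<^sub>R x \<in> ?N} \<inter> (cball 0 1 - {0}) = {}"
    by force
  then have "emeasure (sphere_measure r) ?N = 0"
    by (subst emeasure_sphere_measure) auto
  then show "?N \<in> null_sets (sphere_measure r)"
    by (simp add: null_sets_def sphere_measure_def)
qed auto

text \<open>The flux integrands below are constant on spheres, so this case replaces integration in
  polar coordinates.\<close>

lemma integral_sphere_measure_const:
  fixes f :: "real^'n::finite \<Rightarrow> real"
  assumes r: "r > 0" and f: "f \<in> borel_measurable borel" and c: "\<And>x. norm x = r \<Longrightarrow> f x = c"
  shows "(\<integral>x. f x \<partial>sphere_measure r) = c * (real CARD('n) * r ^ (CARD('n) - 1) *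
    measure lborel (cball 0 1 :: (real^'n) set))"
proof -
  have sets: "sets (sphere_measure r :: (real^'n) measure) = sets borel"
    by (simp add: sphere_measure_def)
  have space: "space (sphere_measure r :: (real^'n) measure) = UNIV"
    by (simp add: sphere_measure_def space_scale_measure)
  have "(\<integral>x. f x \<partial>sphere_measure r) = (\<integral>x. c \<partial>(sphere_measure r :: (real^'n) measure))"
  proof (rule integral_cong_AE)
    show "AE x in sphere_measure r. f x = c"
      using AE_sphere_measure[OF r] by eventually_elim (rule c)
  qed (use f measurable_cong_sets[OF sets refl] in auto)
  also have "\<dots> = c * measure (sphere_measure r :: (real^'n) measure) UNIV"
    by (simp add: space)
  finally show ?thesis
    using sphere_measure_eq(1)[of "UNIV :: (real^'n) set" r] r by simp
qed

text \<open>The divergence of the metric contributes one copy of the gradient of the conformal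
  factor and its trace contributes n copies, which explains the factor 1 - n. The field vanishes on
  the sphere and adds nothing.\<close>

lemma ADM_flux_conformal_radial:
  fixes Y :: "real^'n::finite \<Rightarrow> real^'n"
  assumes F: "F \<in> smooth_real" and F': "\<And>t. (F has_real_derivative F' t) (at t)"
    and Y: "continuous_on UNIV Y" "\<And>x. norm x = r \<Longrightarrow> Y x = 0" and r: "r > 0"
  shows "ADM_flux (conformal_metric (\<lambda>x. F (x \<bullet> x))) Y r =
    - 4 * (real CARD('n) - 1) * F' (r\<^sup>2) * exp (2 * F (r\<^sup>2)) * r *
    (real CARD('n) * r ^ (CARD('n) - 1) * measure lborel (cball 0 1 :: (real^'n) set))"
proof -
  let ?f = "\<lambda>x::real^'n. F (x \<bullet> x)"
  have d: "?f differentiable at x" for x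
    using F by (intro radial_algebra_differentiable radial_algebra.radial)
  have eq: "(\<Sum>i\<in>UNIV. ((\<Sum>l\<in>UNIV. partial_deriv l (\<lambda>y. conformal_metric ?f y $ i $ l) x)
                 - (\<Sum>l\<in>UNIV. partial_deriv i (\<lambda>y. conformal_metric ?f y $ l $ l) x)
                 + 2 * Y x $ i) * (x $ i / norm x))
    = - 4 * (real CARD('n) - 1) * F' (x \<bullet> x) * exp (2 * F (x \<bullet> x)) * ((x \<bullet> x) / norm x)
      + 2 * (Y x \<bullet> x) / norm x" for x
  proof -
    define P where "P = 4 * exp (2 * F (x \<bullet> x)) * F' (x \<bullet> x)"
    define c where "c = real CARD('n)"
    have 1: "(\<Sum>l\<in>UNIV. partial_deriv l (\<lambda>y. conformal_metric ?f y $ i $ l) x) = P * x $ i" for i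
      unfolding partial_deriv_conformal_metric[OF d] partial_deriv_radial[OF F']
      by (simp add: P_def)
    have 2: "(\<Sum>l\<in>UNIV. partial_deriv i (\<lambda>y. conformal_metric ?f y $ l $ l) x) = c * P * x $ i" for i
      unfolding partial_deriv_conformal_metric[OF d] partial_deriv_radial[OF F']
      by (simp add: P_def c_def)
    have "(\<Sum>i\<in>UNIV. (P * x $ i - c * P * x $ i + 2 * Y x $ i) * (x $ i / norm x))
      = (\<Sum>i\<in>UNIV. (1 - c) * P / norm x * (x $ i * x $ i) + 2 / norm x * (Y x $ i * x $ i))"
      by (intro sum.cong refl) (simp add: algebra_simps add_divide_distrib diff_divide_distrib)
    also have "\<dots> = (1 - c) * P / norm x * (x \<bullet> x) + 2 / norm x * (Y x \<bullet> x)"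
      by (simp add: sum.distrib sum_distrib_left inner_vec_def)
    finally show ?thesis
      unfolding 1 2 by (simp add: P_def c_def algebra_simps diff_divide_distrib)
  qed
  \<comment> \<open>\<open>F'\<close> is assumed only to be a derivative; uniqueness identifies it
    with a smooth function and yields the continuity needed for measurability.\<close>
  obtain a where a: "a \<in> smooth_real" "\<And>t. (F has_real_derivative a t) (at t)"
    using smooth_real_has_derivative[OF F] by blast
  have "F' = a"
    using DERIV_unique[OF F' a(2)] by blast
  then have cF: "continuous_on UNIV F" "continuous_on UNIV F'"
    using F a by (auto intro: smooth_real_continuous)
  have c: "(\<lambda>x::real^'n. h (x \<bullet> x)) \<in> borel_measurable borel" if "continuous_on UNIV h" for h :: "real \<Rightarrow> real"
    by (intro borel_measurable_continuous_onI continuous_on_compose2[OF that]) (auto intro!: continuous_intros)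
  note [measurable] = c[OF cF(1)] c[OF cF(2)] borel_measurable_continuous_onI[OF Y(1)]
  show ?thesis
    unfolding ADM_flux_def eq
  proof (rule integral_sphere_measure_const[OF r])
    show "(\<lambda>x. - 4 * (real CARD('n) - 1) * F' (x \<bullet> x) * exp (2 * F (x \<bullet> x)) * ((x \<bullet> x) / norm x)
      + 2 * (Y x \<bullet> x) / norm x) \<in> borel_measurable borel"
      by measurable
  qed (use Y r in \<open>auto simp: dot_square_norm power2_eq_square\<close>)
qed

subsection \<open>The radial profiles\<close>

lemma smooth_real_has_derivatives:
  assumes "a \<in> smooth_real"
  obtains a' a'' where "a' \<in> smooth_real" "a'' \<in> smooth_real"
    "\<And>t. (a has_real_derivative a' t) (at t)" "\<And>t. (a' has_real_derivative a'' t) (at t)"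
  using assms by (metis smooth_real_has_derivative)

text \<open>Derivatives of members of \<open>smooth_real\<close> are obtained abstractly. They
  become explicit wherever the profile agrees locally with a known function.\<close>

lemma derivative_eq_on_open:
  assumes "\<And>t. (a has_real_derivative a' t) (at t)" "open S" "s \<in> S"
    and "\<And>t. t \<in> S \<Longrightarrow> a t = b t" "(b has_real_derivative d) (at s)"
  shows "a' s = d"
proof -
  have "(a has_real_derivative d) (at s)"
    using assms(5,2,3) by (rule has_field_derivative_transform_within_open) (simp add: assms(4))
  then show ?thesis
    using assms(1) DERIV_unique by blast
qed

text \<open>Near the origin the profile is constant, hence flat; far away it is the Schwarzschild profile
  \<open>u^(4/(n-2))\<close> of negative mass with \<open>u = 1 - r^(2-n)/2\<close>.\<close>

lemma schwarzschild_profile: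
  fixes n :: real
  assumes n: "n > 2"
  obtains v v' v'' where "v \<in> smooth_real" "v' \<in> smooth_real" "v'' \<in> smooth_real"
    "\<And>t. (v has_real_derivative v' t) (at t)" "\<And>t. (v' has_real_derivative v'' t) (at t)"
    "\<And>t. v t \<le> 0" "\<And>t. 2 / (n - 2) * ln (1/2) \<le> v t"
    "\<And>t. t < 1 \<Longrightarrow> v' t = 0" "\<And>t. t < 1 \<Longrightarrow> v'' t = 0"
    "\<And>t y u. t > 2 \<Longrightarrow> y = t powr (- n / 2) \<Longrightarrow> u = 1 - t * y / 2 \<Longrightarrow>
      v t = 2 / (n - 2) * ln u \<and> v' t = y / (2 * u) \<and>
      v'' t = - (n * y / (4 * t * u) + (n - 2) * y\<^sup>2 / (8 * u\<^sup>2))"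
proof -
  obtain H where H: "H \<in> smooth_real" "\<And>t. t \<le> 1 \<Longrightarrow> H t = 0" "\<And>t. t \<ge> 2 \<Longrightarrow> H t = 1"
    "\<And>t. 0 \<le> H t"
    using smooth_step_exists by metis
  \<comment> \<open>A smooth substitute for t that equals 1 up to t = 1 and t from t = 2 on. As it
    never drops below 1, \<open>u\<close> stays in [1/2, 1] and does not reach its zero.\<close>
  define P where "P = (\<lambda>t. 1 + H t * (t - 1))"
  define u where "u = (\<lambda>t. 1 - 1/2 * P t powr (1 - n / 2))"
  define v where "v = (\<lambda>t. 2 / (n - 2) * ln (u t))"
  have P_ge: "P t \<ge> 1" for t
    using H(2)[of t] H(4)[of t] by (cases "t \<le> 1") (auto simp: P_def)
  have P1: "P t = 1" if "t \<le> 1" for t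
    using that by (simp add: P_def H)
  have P2: "P t = t" if "t \<ge> 2" for t
    using that by (simp add: P_def H)
  have u_le: "u t \<le> 1" for t by (simp add: u_def)
  have "P t powr (1 - n / 2) \<le> 1" for t
    using powr_mono[of "1 - n / 2" 0 "P t"] P_ge[of t] n by simp
  then have u_ge: "u t \<ge> 1/2" for t
    by (simp add: u_def)
  have u_pos: "u t > 0" for t
    using u_ge[of t] by simp
  have P_pos: "P t > 0" for t
    using P_ge[of t] by simp
  have "P \<in> smooth_real"
    unfolding P_def by (intro smooth_real.add smooth_real.const smooth_real.mult H smooth_real_diff smooth_real.id)
  then have "u \<in> smooth_real"
    unfolding u_def
    by (intro smooth_real_diff smooth_real.const smooth_real_cmult smooth_real_powr P_pos)
  then have v: "v \<in> smooth_real"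
    unfolding v_def by (intro smooth_real_cmult smooth_real.ln u_pos)
  then obtain v' v'' where v': "v' \<in> smooth_real" "v'' \<in> smooth_real"
    "\<And>t. (v has_real_derivative v' t) (at t)" "\<And>t. (v' has_real_derivative v'' t) (at t)"
    using smooth_real_has_derivatives by metis
  have "v t \<le> 0" for t
    unfolding v_def using n u_le[of t] u_pos[of t] by (intro mult_nonneg_nonpos) auto
  moreover have "2 / (n - 2) * ln (1/2) \<le> v t" for t
    unfolding v_def using u_ge[of t] u_pos[of t] n by (intro mult_left_mono) auto
  moreover have v'0: "v' t = 0" if "t < 1" for t
    by (rule derivative_eq_on_open[OF v'(3), of "{..<1}" _ "\<lambda>_. v 0"]) (use that in \<open>auto simp: v_def u_def P1\<close>)
  moreover have "v'' t = 0" if "t < 1" for t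
    by (rule derivative_eq_on_open[OF v'(4), of "{..<1}" _ "\<lambda>_. 0"]) (use that in \<open>auto simp: v'0\<close>)
  moreover have "v t = 2 / (n - 2) * ln w \<and> v' t = y / (2 * w) \<and>
      v'' t = - (n * y / (4 * t * w) + (n - 2) * y\<^sup>2 / (8 * w\<^sup>2))"
    if t: "t > 2" and y: "y = t powr (- n / 2)" and w: "w = 1 - t * y / 2" for t y w
  proof -
    \<comment> \<open>Writing t^(1-n/2) as t Y makes the derivatives rational in t, Y and U, so that
      field arithmetic settles them.\<close>
    define Y where "Y t = t powr (- n / 2)" for t :: real
    define U where "U t = 1 - t * Y t / 2" for t
    have uU: "u t = U t" if "t \<ge> 2" for t
      using that powr_add[of t 1 "- n / 2"] by (simp add: u_def U_def Y_def P2)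
    have dY: "(Y has_real_derivative - n / 2 * (Y t / t)) (at t)" if "t > 2" for t
      unfolding Y_def[abs_def] using that by (auto intro!: derivative_eq_intros simp: powr_diff)
    have dU: "(U has_real_derivative (n - 2) / 4 * Y t) (at t)" if "t > 2" for t
      unfolding U_def[abs_def] using that
      by (auto intro!: derivative_eq_intros dY simp: field_simps)
    have U_pos: "U t > 0" if "t \<ge> 2" for t
      using uU[OF that] u_pos[of t] by simp
    have v'_eq: "v' t = Y t / (2 * U t)" if t: "t > 2" for t
    proof (rule derivative_eq_on_open[OF v'(3), of "{2<..}"])
      have "((\<lambda>t. ln (U t)) has_real_derivative (n - 2) / 4 * Y t / U t) (at t)"
        using t U_pos[of t] by (auto intro!: derivative_eq_intros dU)
      from DERIV_cmult[OF this, of "2 / (n - 2)"]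
      show "((\<lambda>t. 2 / (n - 2) * ln (U t)) has_real_derivative Y t / (2 * U t)) (at t)"
        using n by simp
    qed (use t in \<open>auto simp: v_def uU\<close>)
    have v''_eq: "v'' t = - (n * Y t / (4 * t * U t) + (n - 2) * (Y t)\<^sup>2 / (8 * (U t)\<^sup>2))"
    proof (rule derivative_eq_on_open[OF v'(4), of "{2<..}"])
      show "((\<lambda>t. Y t / (2 * U t)) has_real_derivative
         - (n * Y t / (4 * t * U t) + (n - 2) * (Y t)\<^sup>2 / (8 * (U t)\<^sup>2))) (at t)"
        using t U_pos[of t]
        by (auto intro!: derivative_eq_intros dU dY simp: divide_simps)
           (simp add: power2_eq_square algebra_simps)
    qed (use t in \<open>auto simp: v'_eq\<close>)
    have "Y t = y" "U t = w"
      using y w by (simp_all add: Y_def U_def)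
    then show ?thesis
      using v'_eq[OF t] v''_eq uU[of t] t by (simp add: v_def)
  qed
  ultimately show ?thesis
    using that[OF v v'] by blast
qed

text \<open>The function t (1 - H (t/3)) is t itself up to 3, past the annulus where curvature must
  be compensated, and vanishes from 6 on. The bounds are restricted to t \<ge> 0, the range of x
  \<bullet> x; for negative t the function is unbounded.\<close>

lemma cutoff_profile:
  obtains w w' w'' where "w \<in> smooth_real" "w' \<in> smooth_real" "w'' \<in> smooth_real"
    "\<And>t. (w has_real_derivative w' t) (at t)" "\<And>t. (w' has_real_derivative w'' t) (at t)"
    "\<And>t. t \<ge> 0 \<Longrightarrow> 0 \<le> w t" "\<And>t. t \<ge> 0 \<Longrightarrow> w t \<le> 6"
    "\<And>t. t < 3 \<Longrightarrow> w' t = 1"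
    "\<And>t. t > 6 \<Longrightarrow> w t = 0" "\<And>t. t > 6 \<Longrightarrow> w' t = 0" "\<And>t. t > 6 \<Longrightarrow> w'' t = 0"
proof -
  obtain H where H: "H \<in> smooth_real" "\<And>t. t \<le> 1 \<Longrightarrow> H t = 0" "\<And>t. t \<ge> 2 \<Longrightarrow> H t = 1"
    "\<And>t. 0 \<le> H t" "\<And>t. H t \<le> 1"
    using smooth_step_exists by metis
  define w where "w = (\<lambda>t. t * (1 - H (1/3 * t)))"
  have w: "w \<in> smooth_real"
    unfolding w_def
    by (intro smooth_real.mult smooth_real.id smooth_real_diff smooth_real.const
        smooth_real.comp[OF H(1)] smooth_real_cmult)
  then obtain w' w'' where w': "w' \<in> smooth_real" "w'' \<in> smooth_real"
    "\<And>t. (w has_real_derivative w' t) (at t)" "\<And>t. (w' has_real_derivative w'' t) (at t)"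
    using smooth_real_has_derivatives by metis
  have w0: "w t = 0" if "t > 6" for t
    using that by (simp add: w_def H)
  have w'0: "w' t = 0" if "t > 6" for t
    by (rule derivative_eq_on_open[OF w'(3), of "{6<..}" _ "\<lambda>_. 0"]) (use that in \<open>auto simp: w0\<close>)
  have w''0: "w'' t = 0" if "t > 6" for t
    by (rule derivative_eq_on_open[OF w'(4), of "{6<..}" _ "\<lambda>_. 0"]) (use that in \<open>auto simp: w'0\<close>)
  have w'1: "w' t = 1" if "t < 3" for t
    by (rule derivative_eq_on_open[OF w'(3), of "{..<3}" _ "\<lambda>t. t"]) (use that in \<open>auto simp: w_def H\<close>)
  have ge: "0 \<le> w t" if "t \<ge> 0" for t
    using that H(5) by (simp add: w_def)
  have le: "w t \<le> 6" if "t \<ge> 0" for t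
  proof (cases "t > 6")
    case False
    have "w t \<le> t * 1"
      unfolding w_def using that H(4) by (intro mult_left_mono) auto
    then show ?thesis using False by simp
  qed (simp add: w0)
  show ?thesis
    using that[OF w w' ge le w'1 w0 w'0 w''0] .
qed

theorem mainTheorem7:
  fixes k :: real
  assumes "CARD('n::finite) \<ge> 3"
    and "1 - real CARD('n) < k" and "k < 0"
  shows "\<exists>(g :: real^'n \<Rightarrow> real^'n^'n) (X :: real^'n \<Rightarrow> real^'n).
    riemannian_metric g \<and> complete_metric g \<and> asymptotically_flat g \<and>
    smooth_on UNIV X \<and> compactly_supported X \<and>
    integrable (volume_measure g) (\<lambda>x. scalar_curvature g x + 2 * divergence g X x) \<and>
    (\<forall>x. scalar_curvature_X k g X x \<ge> 0) \<and>
    (\<exists>m. has_X_ADM_mass g X m \<and> m < 0)"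
proof -

  \<comment> \<open>The sign of the gradient coefficient\<close>
  define n where "n = real CARD('n)"
  have n: "n \<ge> 3" using assms(1) by (simp add: n_def)
  define \<epsilon> where "\<epsilon> = (n - 1) * (n - 2) - (1 + 1/k) * (n - 1)\<^sup>2"
  \<comment> \<open>Both bounds on k enter here: for negative k, k > 1 - n inverts to 1/k <
    -1/(n-1).\<close>
  have "1 + 1/k < (n - 2) / (n - 1)"
    using assms(2,3) n by (simp add: n_def field_simps)
  then have "(1 + 1/k) * (n - 1)\<^sup>2 < (n - 2) / (n - 1) * (n - 1)\<^sup>2"
    using n by (intro mult_strict_right_mono) auto
  also have "\<dots> = (n - 1) * (n - 2)"
    using n by (simp add: power2_eq_square)
  finally have \<epsilon>: "\<epsilon> > 0" by (simp add: \<epsilon>_def)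

  \<comment> \<open>Profiles and the curvature of the background metric\<close>
  obtain v v' v'' where v: "v \<in> smooth_real" "v' \<in> smooth_real" "v'' \<in> smooth_real"
    "\<And>t. (v has_real_derivative v' t) (at t)" "\<And>t. (v' has_real_derivative v'' t) (at t)"
    and v_le: "\<And>t. v t \<le> 0" and v_ge: "\<And>t. 2 / (n - 2) * ln (1/2) \<le> v t"
    and v0: "\<And>t. t < 1 \<Longrightarrow> v' t = 0" "\<And>t. t < 1 \<Longrightarrow> v'' t = 0"
    and v2: "\<And>t y u. t > 2 \<Longrightarrow> y = t powr (- n / 2) \<Longrightarrow> u = 1 - t * y / 2 \<Longrightarrow>
      v t = 2 / (n - 2) * ln u \<and> v' t = y / (2 * u) \<and>
      v'' t = - (n * y / (4 * t * u) + (n - 2) * y\<^sup>2 / (8 * u\<^sup>2))"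
    using schwarzschild_profile[of n] n by auto
  obtain w\<^sub>0 w\<^sub>0' w\<^sub>0'' where w\<^sub>0: "w\<^sub>0 \<in> smooth_real" "w\<^sub>0' \<in> smooth_real" "w\<^sub>0'' \<in> smooth_real"
    "\<And>t. (w\<^sub>0 has_real_derivative w\<^sub>0' t) (at t)" "\<And>t. (w\<^sub>0' has_real_derivative w\<^sub>0'' t) (at t)"
    "\<And>t. t \<ge> 0 \<Longrightarrow> 0 \<le> w\<^sub>0 t" "\<And>t. t \<ge> 0 \<Longrightarrow> w\<^sub>0 t \<le> 6"
    "\<And>t. t < 3 \<Longrightarrow> w\<^sub>0' t = 1"
    "\<And>t. t > 6 \<Longrightarrow> w\<^sub>0 t = 0" "\<And>t. t > 6 \<Longrightarrow> w\<^sub>0' t = 0" "\<And>t. t > 6 \<Longrightarrow> w\<^sub>0'' t = 0"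
    using cutoff_profile by blast

  \<comment> \<open>Minus the scalar curvature of the metric exp (2v) \<delta>, multiplied by exp
    (2v).\<close>
  define E where "E t = 2 * (n - 1) * (4 * t * v'' t + 2 * n * v' t) + 4 * (n - 1) * (n - 2) * t * (v' t)\<^sup>2" for t
  have E_continuous: "continuous_on S E" for S
    unfolding E_def
    by (intro continuous_intros continuous_on_subset[OF smooth_real_continuous[OF v(2)]]
        continuous_on_subset[OF smooth_real_continuous[OF v(3)]]) auto
  have u_bounds: "t * t powr (- n / 2) \<le> 1" "1 - t * t powr (- n / 2) / 2 \<ge> 1/2" if "t > 2" for t
  proof -
    have "t powr (1 + - n / 2) \<le> t powr 0"
      using that n by (intro powr_mono) auto
    then show "t * t powr (- n / 2) \<le> 1"
      using that by (simp only: powr_add) simp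
    then show "1 - t * t powr (- n / 2) / 2 \<ge> 1/2" by simp
  qed
  \<comment> \<open>Here u = 1 - r^(2-n)/2 is harmonic, so the Schwarzschild metric is scalar
    flat.\<close>
  have E_outer: "E t = 0" if t: "t > 2" for t
  proof -
    define y where "y = t powr (- n / 2)"
    define u where "u = 1 - t * y / 2"
    have u: "u > 0" using u_bounds[OF t] by (simp add: u_def y_def)
    have v_t: "v' t = y / (2 * u)" "v'' t = - (n * y / (4 * t * u) + (n - 2) * y\<^sup>2 / (8 * u\<^sup>2))"
      using v2[OF t y_def u_def] by auto
    define z where "z = (y / u)\<^sup>2"
    have *: "4 * t * v'' t + 2 * n * v' t = - (n - 2) / 2 * t * z" "(v' t)\<^sup>2 = z / 4"
      unfolding v_t z_def using u t by (simp_all add: field_simps power2_eq_square)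
    show ?thesis
      unfolding E_def * by (simp add: field_simps)
  qed
  have E_inner: "E t = 0" if "t < 1" for t
    using v0[OF that] by (simp add: E_def)
  have "bounded (E ` {1..2})"
    by (intro compact_imp_bounded compact_continuous_image E_continuous) simp
  then obtain M where M: "M > 0" "\<And>t. 1 \<le> t \<Longrightarrow> t \<le> 2 \<Longrightarrow> \<bar>E t\<bar> \<le> M"
    by (auto simp: bounded_pos)

  \<comment> \<open>On the annulus \<open>1 \<le> t \<le> 2\<close> the gradient of \<open>w = A w\<^sub>0\<close> must outweigh the negative curvature of the
    Schwarzschild-like metric.\<close>
  define A where "A = 1 + M / (4 * \<epsilon>)"
  have A: "A \<ge> 1" using M \<epsilon> by (simp add: A_def)
  define w where "w t = A * w\<^sub>0 t" for t
  define w' where "w' t = A * w\<^sub>0' t" for t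
  define w'' where "w'' t = A * w\<^sub>0'' t" for t
  have w: "w \<in> smooth_real" "w' \<in> smooth_real"
    "\<And>t. (w has_real_derivative w' t) (at t)" "\<And>t. (w' has_real_derivative w'' t) (at t)"
    unfolding w_def[abs_def] w'_def[abs_def] w''_def
    by (intro smooth_real_cmult DERIV_cmult w\<^sub>0)+
  have w_outer: "w t = 0" "w' t = 0" "w'' t = 0" if "t > 6" for t
    using w\<^sub>0(9-11) that by (simp_all add: w_def w'_def w''_def)
  define F where "F t = v t - w t" for t
  have F: "F \<in> smooth_real" "\<And>t. (F has_real_derivative v' t - w' t) (at t)"
    unfolding F_def[abs_def] by (intro smooth_real_diff DERIV_diff v w)+
  \<comment> \<open>For t \<ge> 0, \<open>v\<close> lies between 2/(n-2) ln (1/2) and 0, and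
    \<open>w\<close> between 0 and 6 A; hence F lies in [-B, 0].\<close>
  define B where "B = 6 * A - 2 / (n - 2) * ln (1/2)"
  have F_bounds: "\<bar>F t\<bar> \<le> B" if "t \<ge> 0" for t
  proof -
    have "0 \<le> w t" "w t \<le> 6 * A"
      using w\<^sub>0(6,7)[OF that] A by (simp_all add: w_def)
    moreover have "2 / (n - 2) * ln (1/2) \<le> 0"
      using n by (intro mult_nonneg_nonpos) auto
    ultimately show ?thesis
      using v_le[of t] v_ge[of t] unfolding F_def B_def by linarith
  qed

  \<comment> \<open>The metric and the vector field\<close>
  define g where "g = conformal_metric (\<lambda>x::real^'n. F (x \<bullet> x))"
  \<comment> \<open>The differential of -(n-1) w raised with the inverse metric; the factor 2 x
    comes from differentiating x \<bullet> x.\<close>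
  define X where "X = (\<lambda>x::real^'n. (- 2 * (n - 1) * exp (- 2 * F (x \<bullet> x)) * w' (x \<bullet> x)) *\<^sub>R x)"
  note g_eq = g_def[unfolded F_def] and X_eq = X_def[unfolded F_def]
  have F_continuous: "continuous_on S (\<lambda>x::real^'n. F (x \<bullet> x))" for S
    by (intro continuous_on_radial smooth_real_continuous F)
  have E_radial: "scalar_curvature g x + 2 * divergence g X x
      = exp (- 2 * F (x \<bullet> x)) * (4 * (n - 1) * (n - 2) * (x \<bullet> x) * (w' (x \<bullet> x))\<^sup>2 - E (x \<bullet> x))" for x
    unfolding g_eq X_eq
      scalar_curvature_plus_divergence_radial[where 'n = 'n, OF v(4,5) w(3,4) refl, folded n_def]
    by (simp only: E_def F_def)
  have outer: "x \<bullet> x > 6" if "norm x > 3" for x :: "real^'n"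
  proof -
    have "3\<^sup>2 < (norm x)\<^sup>2" using that by (intro power_strict_mono) auto
    then show ?thesis by (simp add: power2_norm_eq_inner)
  qed
  have X_outer: "X x = 0" if "norm x > 3" for x
    using w_outer[OF outer[OF that]] by (simp add: X_def)

  have metric: "riemannian_metric g"
    unfolding riemannian_metric_def
    by (auto simp: g_def smooth_on_conformal_metric F transpose_conformal_metric conformal_metric_mult_vec)

  have complete: "complete_metric g"
  proof (rule complete_metric_if_uniformly_equivalent)
    show "continuous_on UNIV g"
      unfolding g_def conformal_metric_def by (intro continuous_intros F_continuous)
    show "exp (- B) > 0" by simp
    show "exp (- B) * norm u \<le> metric_norm g x u" "metric_norm g x u \<le> exp B * norm u" for x u
      using F_bounds[of "x \<bullet> x"] unfolding g_def metric_norm_conformal_metric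
      by (auto intro!: mult_right_mono)
  qed

  \<comment> \<open>Decay at infinity\<close>
  have decay: "\<bar>exp (2 * F t) - 1\<bar> \<le> (2 * n + 4) * t powr (1 - n / 2)"
    "\<bar>2 * (v' t - w' t) * exp (2 * F t)\<bar> \<le> (2 * n + 4) * t powr (- n / 2)"
    "\<bar>(2 * (v'' t - w'' t) + 4 * (v' t - w' t)\<^sup>2) * exp (2 * F t)\<bar> \<le> (2 * n + 4) * t powr (- n / 2 - 1)"
    if t: "t \<ge> 7" for t
  proof -
    \<comment> \<open>From 7 on both cutoffs are over, so F is the explicit Schwarzschild profile.
      The common constant 2n + 4 is generous: the second derivative, which is the worst, needs 2
      (n-1) + 4.\<close>
    define y where "y = t powr (- n / 2)"
    define u where "u = 1 - t * y / 2"
    have y: "y > 0" "t * y \<le> 1" and u: "u \<ge> 1/2" "u \<le> 1"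
      using u_bounds[of t] t by (auto simp: u_def y_def)
    have v_t: "v t = 2 / (n - 2) * ln u" "v' t = y / (2 * u)"
      "v'' t = - (n * y / (4 * t * u) + (n - 2) * y\<^sup>2 / (8 * u\<^sup>2))"
      using v2[OF _ y_def u_def] t by auto
    have F_t: "F t = v t" and w_t: "w' t = 0" "w'' t = 0"
      using w_outer[of t] t by (auto simp: F_def)
    have powr: "t powr (1 - n / 2) = t * y" "t powr (- n / 2 - 1) = y / t"
      using t powr_add[of t 1 "- n / 2"] by (simp_all add: y_def powr_diff)
    have e: "0 < exp (2 * v t)" "exp (2 * v t) \<le> 1"
      using v_le[of t] by auto
    have iu: "1 / u \<le> 2" using u by (simp add: field_simps)
    have "1 - exp (2 * v t) \<le> - (2 * v t)"
      using exp_ge_add_one_self[of "2 * v t"] by linarith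
    also have "\<dots> = 4 / (n - 2) * (- ln u)"
      by (simp add: v_t)
    also have "\<dots> \<le> 4 / (n - 2) * (t * y)"
    proof (rule mult_left_mono)
      have "- ln u = ln (1 / u)" using u by (simp add: ln_div)
      also have "\<dots> \<le> 1 / u - 1" using u by (intro ln_le_minus_one) simp
      also have "\<dots> = t * y / 2 * (1 / u)" using u by (simp add: u_def field_simps)
      also have "\<dots> \<le> t * y / 2 * 2" using iu y t by (intro mult_left_mono) auto
      finally show "- ln u \<le> t * y" by simp
    qed (use n in simp)
    also have "\<dots> \<le> (2 * n + 4) * (t * y)"
    proof (rule mult_right_mono)
      have "4 / (n - 2) \<le> 4" using n by (simp add: field_simps)
      then show "4 / (n - 2) \<le> 2 * n + 4" using n by linarith
    qed (use y t in simp)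
    finally show "\<bar>exp (2 * F t) - 1\<bar> \<le> (2 * n + 4) * t powr (1 - n / 2)"
      using e by (simp add: F_t powr)
    have v'_le: "0 \<le> v' t" "v' t \<le> y"
      using mult_left_mono[OF iu, of "y / 2"] y u by (simp_all add: v_t)
    have "2 * v' t * exp (2 * v t) \<le> 2 * y * 1"
      using v'_le e by (intro mult_mono) auto
    also have "\<dots> \<le> (2 * n + 4) * y"
      using n y by simp
    finally show "\<bar>2 * (v' t - w' t) * exp (2 * F t)\<bar> \<le> (2 * n + 4) * t powr (- n / 2)"
      unfolding y_def[symmetric] F_t w_t using v'_le e by (simp add: abs_mult)
    \<comment> \<open>Because t y \<le> 1, the terms quadratic in y have at most the order y/t of
      the linear one.\<close>
    have yy: "y\<^sup>2 \<le> y / t"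
      using y t by (simp add: field_simps power2_eq_square)
    have "n * y / (4 * t * u) = n * y / (4 * t) * (1 / u)" by simp
    also have "\<dots> \<le> n * y / (4 * t) * 2"
      using iu n y t by (intro mult_left_mono) auto
    finally have b1: "n * y / (4 * t * u) \<le> n / 2 * (y / t)" by simp
    have "(n - 2) * y\<^sup>2 / (8 * u\<^sup>2) = (n - 2) * y\<^sup>2 / 8 * (1 / u)\<^sup>2"
      by (simp add: power_divide)
    also have "\<dots> \<le> (n - 2) * y\<^sup>2 / 8 * 2\<^sup>2"
      using iu n u by (intro mult_left_mono power_mono) auto
    also have "\<dots> \<le> (n - 2) / 2 * (y / t)"
      using mult_left_mono[OF yy, of "(n - 2) / 2"] n by simp
    finally have b2: "(n - 2) * y\<^sup>2 / (8 * u\<^sup>2) \<le> (n - 2) / 2 * (y / t)" .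
    have "\<bar>v'' t\<bar> \<le> n / 2 * (y / t) + (n - 2) / 2 * (y / t)"
      unfolding v_t(3) abs_minus_cancel using b1 b2 n y t u
      by (subst abs_of_nonneg) (auto intro!: add_nonneg_nonneg)
    moreover have "(v' t)\<^sup>2 \<le> y / t"
      using power_mono[OF v'_le(2,1), of 2] yy by linarith
    moreover have "n / 2 * (y / t) + (n - 2) / 2 * (y / t) = (n - 1) * (y / t)"
      unfolding distrib_right[symmetric] by (rule arg_cong[of _ _ "\<lambda>c. c * (y / t)"]) (simp add: field_simps)
    ultimately have "\<bar>2 * v'' t + 4 * (v' t)\<^sup>2\<bar> \<le> 2 * ((n - 1) * (y / t)) + 4 * (y / t)"
      using zero_le_power2[of "v' t"] by linarith
    moreover have lin: "(2 * ((n - 1) * z) + 4 * z) * 1 \<le> (2 * n + 4) * z" if "z \<ge> 0" for z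
      using that by (simp add: algebra_simps)
    ultimately have "\<bar>2 * v'' t + 4 * (v' t)\<^sup>2\<bar> * exp (2 * v t) \<le> (2 * ((n - 1) * (y / t)) + 4 * (y / t)) * 1"
      using e n y t by (intro mult_mono) auto
    also have "\<dots> \<le> (2 * n + 4) * (y / t)"
      by (rule lin) (use y t in simp)
    finally show "\<bar>(2 * (v'' t - w'' t) + 4 * (v' t - w' t)\<^sup>2) * exp (2 * F t)\<bar>
        \<le> (2 * n + 4) * t powr (- n / 2 - 1)"
      unfolding powr F_t w_t by (simp add: abs_mult)
  qed

  have bigO: "bigO2 (n - 2) (\<lambda>x::real^'n. exp (2 * F (x \<bullet> x)) - 1)"
  proof (rule bigO2_radial[where T = 7 and C = "2 * n + 4"
        and a' = "\<lambda>t. 2 * (v' t - w' t) * exp (2 * F t)"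
        and a'' = "\<lambda>t. (2 * (v'' t - w'' t) + 4 * (v' t - w' t)\<^sup>2) * exp (2 * F t)"
        and a = "\<lambda>t. exp (2 * F t) - 1"])
    show "((\<lambda>t. exp (2 * F t) - 1) has_real_derivative 2 * (v' t - w' t) * exp (2 * F t)) (at t)" for t
      by (auto intro!: derivative_eq_intros F(2))
    show "((\<lambda>t. 2 * (v' t - w' t) * exp (2 * F t)) has_real_derivative
      (2 * (v'' t - w'' t) + 4 * (v' t - w' t)\<^sup>2) * exp (2 * F t)) (at t)" for t
      by (rule derivative_eq_intros v(5) w(4) F(2) refl)+ (simp add: power2_eq_square algebra_simps)
  qed (use decay n in \<open>auto simp: field_simps\<close>)
  have chart: "af_chart g (\<lambda>x. x) (\<lambda>x. x)"
  proof (rule af_chart_ident[of "n - 2"])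
    \<comment> \<open>The decay rate is twice the threshold of asymptotic flatness.\<close>
    show "(real CARD('n) - 2) / 2 < n - 2" using n by (simp add: n_def)
    have "bigO2 (n - 2) (\<lambda>x::real^'n. 0)"
      unfolding bigO2_def by (intro exI[of _ 1]) auto
    with bigO show "bigO2 (n - 2) (\<lambda>y. g y $ i $ j - (if i = j then 1 else 0))" for i j
      by (cases "i = j") (simp_all add: g_def conformal_metric_nth)
  qed

  \<comment> \<open>Regularity of the field and integrability\<close>
  have X_smooth: "smooth_on UNIV X"
    unfolding X_def
    by (intro smooth_on_radial_field[of "\<lambda>t. - 2 * (n - 1) * exp (- 2 * F t) * w' t"]
        smooth_real.mult smooth_real.const smooth_real.exp smooth_real_cmult F w)
  have X_continuous: "continuous_on UNIV X"
    unfolding X_def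
    by (intro continuous_intros F_continuous continuous_on_radial smooth_real_continuous w)
  have support: "compactly_supported X"
  proof -
    have "{x. X x \<noteq> 0} \<subseteq> cball 0 3"
      using X_outer by force
    then have "bounded {x. X x \<noteq> 0}"
      using bounded_cball bounded_subset by blast
    then show ?thesis
      by (simp add: compactly_supported_def compact_closure)
  qed

  have integrable: "integrable (volume_measure g) (\<lambda>x. scalar_curvature g x + 2 * divergence g X x)"
    unfolding g_def
  \<comment> \<open>Outside radius 3, where t > 6, the field vanishes and the metric is scalar flat,
    so the integrand has bounded support.\<close>
  proof (rule integrable_volume_measure_conformal[of _ _ 3])
    show "continuous_on UNIV (\<lambda>x. scalar_curvature (conformal_metric (\<lambda>x. F (x \<bullet> x))) x
        + 2 * divergence (conformal_metric (\<lambda>x. F (x \<bullet> x))) X x)"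
      unfolding E_radial[unfolded g_def]
      by (intro continuous_intros F_continuous continuous_on_radial E_continuous smooth_real_continuous w)
    show "scalar_curvature (conformal_metric (\<lambda>x. F (x \<bullet> x))) x
        + 2 * divergence (conformal_metric (\<lambda>x. F (x \<bullet> x))) X x = 0" if "norm x > 3" for x
      unfolding E_radial[unfolded g_def] using outer[OF that] w_outer[OF outer[OF that]]
      by (simp add: E_outer)
  qed (rule F_continuous)

  \<comment> \<open>Nonnegativity of the modified curvature\<close>
  have nonneg: "scalar_curvature_X k g X x \<ge> 0" for x
  proof -
    define t where "t = x \<bullet> x"
    have "scalar_curvature_X k g X x = exp (- 2 * F t) *
       (4 * (n - 1) * (n - 2) * t * (w' t)\<^sup>2 - E t) - (1 + 1/k) * (exp (- 2 * F t) * (4 * (n - 1)\<^sup>2 * t * (w' t)\<^sup>2))"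
      unfolding scalar_curvature_X_def E_radial
      unfolding g_eq X_eq metric_norm_radial_gradient[where 'n = 'n, OF v(4,5) w(3,4) refl, folded n_def]
      by (simp only: t_def F_def)
    also have "\<dots> = exp (- 2 * F t) * (4 * \<epsilon> * (t * (w' t)\<^sup>2) - E t)"
      by (simp add: \<epsilon>_def algebra_simps)
    finally have eq: "scalar_curvature_X k g X x = exp (- 2 * F t) * (4 * \<epsilon> * (t * (w' t)\<^sup>2) - E t)" .
    have "t \<ge> 0" by (simp add: t_def)
    have "E t \<le> 4 * \<epsilon> * (t * (w' t)\<^sup>2)"
    proof (cases "1 \<le> t \<and> t \<le> 2")
      case True
      have "E t \<le> M" using M(2)[of t] True by simp
      \<comment> \<open>The choice of A gives 4 \<epsilon> A = 4 \<epsilon> + M. Its summand 1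
        ensures A \<ge> 1, so A is at most its square, and t \<ge> 1 on the annulus absorbs the
        remaining factor.\<close>
      also have "M \<le> 4 * \<epsilon> * A" using \<epsilon> by (simp add: A_def algebra_simps)
      also have "\<dots> \<le> 4 * \<epsilon> * (t * A\<^sup>2)"
      proof (intro mult_left_mono)
        have "A * 1 \<le> A * A" using A by (intro mult_left_mono) auto
        also have "1 * (A * A) \<le> t * (A * A)" using True A by (intro mult_right_mono) auto
        then have "A * A \<le> t * (A * A)" by simp
        finally show "A \<le> t * A\<^sup>2" by (simp add: power2_eq_square)
      qed (use \<epsilon> in simp)
      finally show ?thesis
        using w\<^sub>0(8)[of t] True by (simp add: w'_def)
    next
      case False
      then have "E t = 0" using E_inner[of t] E_outer[of t] by linarith
      then show ?thesis using \<epsilon> \<open>t \<ge> 0\<close> by simp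
    qed
    then show ?thesis by (simp add: eq)
  qed

  \<comment> \<open>The mass\<close>
  have mass: "has_X_ADM_mass g X (- 1)"
    unfolding has_X_ADM_mass_def
  proof (intro exI conjI)
    show "af_chart g (\<lambda>x. x) (\<lambda>x. x)" by (rule chart)
    define \<kappa> where "\<kappa> = measure lborel (cball 0 1 :: (real^'n) set)"
    have \<kappa>: "\<kappa> > 0"
      by (simp add: \<kappa>_def)
    \<comment> \<open>Beyond radius 3 the normalised flux is exactly -u^(4/(n-2)) / u. It tends to
      -1 because u tends to 1, in accordance with u = 1 + m / (2 r^(n-2)) for m = -1.\<close>
    have "\<forall>\<^sub>F r in at_top. - exp (2 / (n - 2) * ln (1 - r powr (2 - n) / 2) * 2) / (1 - r powr (2 - n) / 2)
      = 1 / (2 * (real CARD('n) - 1) * measure (sphere_measure 1 :: (real^'n) measure) (sphere 0 1))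
            * ADM_flux (chart_metric (\<lambda>x. x) g) (chart_field (\<lambda>x. x) (\<lambda>x. x) X) r"
      using eventually_gt_at_top[of 3]
    proof eventually_elim
      fix r :: real assume r: "r > 3"
      define y where "y = (r\<^sup>2) powr (- n / 2)"
      define u where "u = 1 - r\<^sup>2 * y / 2"
      have "3\<^sup>2 < r\<^sup>2" using r by (intro power_strict_mono) auto
      then have r2: "r\<^sup>2 > 6" by simp
      have y_eq: "y = r powr (- n)"
        using r powr_powr[of r 2 "- n / 2"] by (simp add: y_def)
      have u_eq: "1 - r powr (2 - n) / 2 = u"
        using r powr_add[of r 2 "- n"] by (simp add: u_def y_eq)
      \<comment> \<open>The derivative of the profile decays exactly as fast as r times the area of
        the sphere grows.\<close>
      have "y * (r * r ^ (CARD('n) - 1)) = r powr (- n) * r powr n"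
        using r assms(1) by (simp add: y_eq n_def powr_realpow power_eq_if)
      also have "\<dots> = 1"
        using r by (simp add: powr_add[symmetric])
      finally have y1: "y * (r * r ^ (CARD('n) - 1)) = 1" .
      have v_r: "v (r\<^sup>2) = 2 / (n - 2) * ln u" "v' (r\<^sup>2) = y / (2 * u)"
        using v2[OF _ y_def u_def] r2 by auto
      have F_r: "F (r\<^sup>2) = v (r\<^sup>2)" "w' (r\<^sup>2) = 0"
        using w_outer[OF r2] by (simp_all add: F_def)
      have "ADM_flux g X r = - 4 * (n - 1) * (v' (r\<^sup>2) - w' (r\<^sup>2)) * exp (2 * F (r\<^sup>2)) * r *
        (n * r ^ (CARD('n) - 1) * \<kappa>)"
        unfolding g_def n_def \<kappa>_def using r X_outer
        by (intro ADM_flux_conformal_radial F X_continuous) auto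
      also have "\<dots> = - 2 * (n - 1) * n * \<kappa> * (exp (2 * v (r\<^sup>2)) / u) * (y * (r * r ^ (CARD('n) - 1)))"
        using u_bounds(2)[of "r\<^sup>2"] r2 by (simp add: F_r v_r(2) u_def y_def field_simps)
      also have "\<dots> = - (exp (2 * v (r\<^sup>2)) / u) * (2 * (n - 1) * (n * \<kappa>))"
        unfolding y1 by (simp add: algebra_simps diff_divide_distrib)
      finally have flux: "ADM_flux g X r = - (exp (2 * v (r\<^sup>2)) / u) * (2 * (n - 1) * (n * \<kappa>))" .
      have "measure (sphere_measure 1 :: (real^'n) measure) (sphere 0 1) = n * \<kappa>"
        by (subst sphere_measure_eq) (auto simp: n_def \<kappa>_def)
      then show "- exp (2 / (n - 2) * ln (1 - r powr (2 - n) / 2) * 2) / (1 - r powr (2 - n) / 2)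
        = 1 / (2 * (real CARD('n) - 1) * measure (sphere_measure 1 :: (real^'n) measure) (sphere 0 1))
            * ADM_flux (chart_metric (\<lambda>x. x) g) (chart_field (\<lambda>x. x) (\<lambda>x. x) X) r"
        unfolding chart_metric_ident chart_field_ident flux u_eq v_r n_def[symmetric]
        using n \<kappa> by (simp add: mult_ac)
    qed
    \<comment> \<open>The value 0 stands for the limit of r^(2-n), so that the limit rules apply
      structurally; the expression simplifies to -1.\<close>
    moreover have "((\<lambda>r. - exp (2 / (n - 2) * ln (1 - r powr (2 - n) / 2) * 2) / (1 - r powr (2 - n) / 2))
        \<longlongrightarrow> - exp (2 / (n - 2) * ln (1 - 0 / 2) * 2) / (1 - 0 / 2)) at_top"
      using n by (intro tendsto_intros tendsto_neg_powr filterlim_ident) auto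
    ultimately show "((\<lambda>r. 1 / (2 * (real CARD('n) - 1) * measure (sphere_measure 1 :: (real^'n) measure) (sphere 0 1))
            * ADM_flux (chart_metric (\<lambda>x. x) g) (chart_field (\<lambda>x. x) (\<lambda>x. x) X) r) \<longlongrightarrow> - 1) at_top"
      by (elim Lim_transform_eventually[rotated]) simp
  qed

  have "asymptotically_flat g"
    using chart unfolding asymptotically_flat_def by blast
  moreover have "\<exists>m. has_X_ADM_mass g X m \<and> m < 0"
    using mass by (intro exI[of _ "- 1"]) simp
  ultimately show ?thesis
    using metric complete X_smooth support integrable nonneg by blast
qed

end
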